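(* Let $0<\alpha<1$, $\theta=\alpha/2$, $\kappa\in\mathbb{R}$, $\kappa_+=\max\{\kappa,0\}$, and let $0=t_0<t_1<\cdots<t_N=T$ be time levels whose local step-size ratios satisfy $\rho_k\le7/4$ for $1\le k\le N-1$, and whose maximum step size $\tau=\max_{1\le k\le N}\tau_k$ satisfies $$\tau\le\frac{1}{\sqrt[\alpha]{11\,\Gamma(2-\alpha)\,\kappa_+}}$$ (no restriction on $\tau$ if $\kappa\le0$). Let $u_h^n\in X_h$ ($0\le n\le N$) be the solution of the time-stepping scheme: $u_h^0=u_{0h}\in X_h$ and, for $1\le n\le N$ and all $\chi\in X_h$, $$\langle(\mathcal{D}^{\alpha}_\tau u_h)^{n-\theta},\chi\rangle+\langle\nabla u_h^{n-\theta},\nabla\chi\rangle=\kappa\langle u_h^{n-\theta},\chi\rangle+\langle f(t_{n-\theta}),\chi\rangle .$$ Then, for $1\le n\le N$, $$\|u^n_h\|\le2E_\alpha\bigl(20\kappa_{+}t_n^\alpha\bigr)\Big(\|u_{0h}\|+2\max_{1\le k\le n}\sum_{j=1}^kP^{(k)}_{k-j}\|f(t_{j-\theta})\|\Big)$$ $$\le2E_\alpha\bigl(20\kappa_{+}t_n^\alpha\bigr)\Big(\|u_{0h}\|+6\,\Gamma(1-\alpha)\max_{1\le j\le n}\big\{t_j^{\alpha}\|f(t_{j-\theta})\|\big\}\Big).$$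
   Context: $\Omega\subset\mathbb{R}^d$ ($d\in\{1,2,3\}$) is a bounded domain; $\langle\cdot,\cdot\rangle$ and $\|\cdot\|$ are the inner product and norm of $L_2(\Omega)$; $f(t)\in L_2(\Omega)$ is the source term. $X_h\subset H_0^1(\Omega)$ is the space of continuous piecewise-linear functions, vanishing on $\partial\Omega$, with respect to a partition of $\Omega$ into intervals/triangles/tetrahedra of maximum diameter $h$. $E_\alpha(z)=\sum_{k=0}^\infty z^k/\Gamma(1+k\alpha)$ is the Mittag-Leffler function. Notation. $\omega_\beta(t)=t^{\beta-1}/\Gamma(\beta)$ for $t>0$. Step sizes $\tau_k=t_k-t_{k-1}$ ($1\le k\le N$), ratios $\rho_k=\tau_k/\tau_{k+1}$ ($1\le k\le N-1$), $t_{n-\theta}=\theta t_{n-1}+(1-\theta)t_n$, $t_{k-1/2}=(t_{k-1}+t_k)/2$, $\varpi_n'(s)=\omega_{1-\alpha}(t_{n-\theta}-s)$ for $0\le s<t_{n-\theta}$. Coefficients: $$a^{(n)}_{n-k}=\frac{1}{\tau_k}\int_{t_{k-1}}^{\min\{t_k,t_{n-\theta}\}}\varpi_n'(s)\,ds\quad(1\le k\le n),$$ $$b^{(n)}_{n-k}=\frac{2}{\tau_k(\tau_k+\tau_{k+1})}\int_{t_{k-1}}^{t_k}(s-t_{k-1/2})\varpi_n'(s)\,ds\quad(1\le k\le n-1).$$ Alikhanov kernels: $A^{(1)}_0=a^{(1)}_0$ and, for $n\ge2$, $$A^{(n)}_{0}=a^{(n)}_0+\rho_{n-1}b^{(n)}_1,\qquad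 A^{(n)}_{n-k}=a^{(n)}_{n-k}+\rho_{k-1}b^{(n)}_{n-k+1}-b^{(n)}_{n-k}\ (2\le k\le n-1),\qquad A^{(n)}_{n-1}=a^{(n)}_{n-1}-b^{(n)}_{n-1}.$$ For a sequence $(v^k)_{k=0}^N$: $v^{n-\theta}=\theta v^{n-1}+(1-\theta)v^n$ and $(\mathcal{D}^\alpha_\tau v)^{n-\theta}=\sum_{k=1}^nA^{(n)}_{n-k}(v^k-v^{k-1})$. Complementary discrete kernels: $P^{(n)}_0=1/A^{(n)}_0$ and $$P^{(n)}_{n-j}=\frac{1}{A^{(j)}_0}\sum_{k=j+1}^n\big(A^{(k)}_{k-j-1}-A^{(k)}_{k-j}\big)P^{(n)}_{n-k},\quad 1\le j\le n-1;$$ equivalently $\sum_{j=k}^nP^{(n)}_{n-j}A^{(j)}_{j-k}=1$ for $1\le k\le n\le N$. *)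

theory Defs
  imports "HOL-Analysis.Analysis"
begin

section \<open>Square-integrable functions and the gradient\<close>

text \<open>Stated for values in an inner product space, so that the same definitions serve
  scalar functions and gradients.\<close>

definition L2_space :: "'a::euclidean_space set \<Rightarrow> ('a \<Rightarrow> 'b::euclidean_space) set" where
  "L2_space \<Omega> = {g. g \<in> borel_measurable (lebesgue_on \<Omega>) \<and>
                    integrable (lebesgue_on \<Omega>) (\<lambda>x. (norm (g x))\<^sup>2)}"

definition l2_inner ::
  "'a::euclidean_space set \<Rightarrow> ('a \<Rightarrow> 'b::euclidean_space) \<Rightarrow> ('a \<Rightarrow> 'b) \<Rightarrow> real" where
  "l2_inner \<Omega> u v = (\<integral>x. u x \<bullet> v x \<partial>lebesgue_on \<Omega>)"

definition l2_norm :: "'a::euclidean_space set \<Rightarrow> ('a \<Rightarrow> 'b::euclidean_space) \<Rightarrow> real" where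
  "l2_norm \<Omega> u = sqrt (l2_inner \<Omega> u u)"

text \<open>The pointwise gradient.  A continuous piecewise linear function is differentiable off
  the boundaries of the mesh elements, a null set, and there this is its weak gradient.\<close>

definition grad :: "('a::euclidean_space \<Rightarrow> real) \<Rightarrow> 'a \<Rightarrow> 'a" where
  "grad u x = (THE D. GDERIV u x :> D)"


section \<open>The finite element space\<close>

text \<open>Hanging nodes are not excluded: distinct elements only have to have disjoint interiors.\<close>

definition simplicial_partition ::
  "'a::euclidean_space set \<Rightarrow> 'a set set \<Rightarrow> real \<Rightarrow> bool" where
  "simplicial_partition \<Omega> \<T> h \<longleftrightarrow>
     finite \<T> \<and> (\<forall>K\<in>\<T>. int DIM('a) simplex K) \<and>
     pairwise (\<lambda>K L. interior K \<inter> interior L = {}) \<T> \<and>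
     \<Union>\<T> = closure \<Omega> \<and> h = Max (diameter ` \<T>)"

text \<open>Functions on \<open>\<Omega>\<close> are represented by their extension by zero, so the last condition
  contains the homogeneous boundary condition (\<open>\<Omega>\<close> is open).\<close>

definition fe_space :: "'a::euclidean_space set \<Rightarrow> 'a set set \<Rightarrow> ('a \<Rightarrow> real) set" where
  "fe_space \<Omega> \<T> = {u. continuous_on (closure \<Omega>) u \<and>
                      (\<forall>K\<in>\<T>. \<exists>a b. \<forall>x\<in>K. u x = a \<bullet> x + b) \<and>
                      (\<forall>x. x \<notin> \<Omega> \<longrightarrow> u x = 0)}"


section \<open>Time grid and Alikhanov kernels\<close>

definition omega :: "real \<Rightarrow> real \<Rightarrow> real" where
  "omega \<beta> s = s powr (\<beta> - 1) / Gamma \<beta>"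

definition time_step :: "(nat \<Rightarrow> real) \<Rightarrow> nat \<Rightarrow> real" where
  "time_step t k = t k - t (k - 1)"

definition step_ratio :: "(nat \<Rightarrow> real) \<Rightarrow> nat \<Rightarrow> real" where
  "step_ratio t k = time_step t k / time_step t (k + 1)"

text \<open>\<open>offset \<theta> v n\<close> is \<open>v\<^bsup>n-\<theta>\<^esup>\<close>; applied to the grid itself it gives \<open>t\<^bsub>n-\<theta>\<^esub>\<close>.\<close>

definition offset :: "real \<Rightarrow> (nat \<Rightarrow> real) \<Rightarrow> nat \<Rightarrow> real" where
  "offset \<theta> v n = \<theta> * v (n - 1) + (1 - \<theta>) * v n"

text \<open>All kernels below are indexed by the two time levels: \<open>coef_a \<alpha> \<theta> t n k\<close> stands for
  \<open>a\<^bsup>(n)\<^esup>\<^bsub>n-k\<^esub>\<close>, and likewise for \<open>b\<close>, \<open>A\<close> and \<open>P\<close>.  For \<open>k = n\<close> the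
  integrand of \<open>a\<close> is singular at the right endpoint, where \<open>omega\<close> takes the harmless
  value \<open>0\<close>.\<close>

definition coef_a :: "real \<Rightarrow> real \<Rightarrow> (nat \<Rightarrow> real) \<Rightarrow> nat \<Rightarrow> nat \<Rightarrow> real" where
  "coef_a \<alpha> \<theta> t n k =
     1 / time_step t k *
     integral {t (k - 1)..min (t k) (offset \<theta> t n)} (\<lambda>s. omega (1 - \<alpha>) (offset \<theta> t n - s))"

definition coef_b :: "real \<Rightarrow> real \<Rightarrow> (nat \<Rightarrow> real) \<Rightarrow> nat \<Rightarrow> nat \<Rightarrow> real" where
  "coef_b \<alpha> \<theta> t n k =
     2 / (time_step t k * (time_step t k + time_step t (k + 1))) *
     integral {t (k - 1)..t k}
       (\<lambda>s. (s - (t (k - 1) + t k) / 2) * omega (1 - \<alpha>) (offset \<theta> t n - s))"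

text \<open>Only meaningful for \<open>1 \<le> k \<le> n\<close>; the final branch is \<open>k = 1 < n\<close>.\<close>

definition kernel_A :: "real \<Rightarrow> real \<Rightarrow> (nat \<Rightarrow> real) \<Rightarrow> nat \<Rightarrow> nat \<Rightarrow> real" where
  "kernel_A \<alpha> \<theta> t n k =
     (if n = 1 then coef_a \<alpha> \<theta> t 1 1
      else if k = n then coef_a \<alpha> \<theta> t n n + step_ratio t (n - 1) * coef_b \<alpha> \<theta> t n (n - 1)
      else if 2 \<le> k then coef_a \<alpha> \<theta> t n k + step_ratio t (k - 1) * coef_b \<alpha> \<theta> t n (k - 1)
                         - coef_b \<alpha> \<theta> t n k
      else coef_a \<alpha> \<theta> t n 1 - coef_b \<alpha> \<theta> t n 1)"

definition frac_diff ::
  "real \<Rightarrow> real \<Rightarrow> (nat \<Rightarrow> real) \<Rightarrow> (nat \<Rightarrow> real) \<Rightarrow> nat \<Rightarrow> real" where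
  "frac_diff \<alpha> \<theta> t v n = (\<Sum>k=1..n. kernel_A \<alpha> \<theta> t n k * (v k - v (k - 1)))"

function kernel_P :: "real \<Rightarrow> real \<Rightarrow> (nat \<Rightarrow> real) \<Rightarrow> nat \<Rightarrow> nat \<Rightarrow> real" where
  "kernel_P \<alpha> \<theta> t n j =
     (if n \<le> j then 1 / kernel_A \<alpha> \<theta> t n n
      else 1 / kernel_A \<alpha> \<theta> t j j *
           (\<Sum>k=j+1..n. (kernel_A \<alpha> \<theta> t k (j + 1) - kernel_A \<alpha> \<theta> t k j) * kernel_P \<alpha> \<theta> t n k))"
  by pat_completeness auto
termination
  by (relation "Wellfounded.measure (\<lambda>(\<alpha>, \<theta>, t, n, j). n - j)") auto

declare kernel_P.simps [simp del]

lemma kernel_P_complementary: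
  assumes "\<And>j. k \<le> j \<Longrightarrow> j \<le> n \<Longrightarrow> kernel_A \<alpha> \<theta> t j j \<noteq> 0" and "k \<le> n"
  shows "(\<Sum>j=k..n. kernel_P \<alpha> \<theta> t n j * kernel_A \<alpha> \<theta> t j k) = 1"
  using assms(2,1)
proof (induction k rule: inc_induct)
  case base
  then show ?case by (simp add: kernel_P.simps)
next
  case (step k)
  have "kernel_P \<alpha> \<theta> t n k * kernel_A \<alpha> \<theta> t k k =
    (\<Sum>j=k+1..n. (kernel_A \<alpha> \<theta> t j (k + 1) - kernel_A \<alpha> \<theta> t j k) * kernel_P \<alpha> \<theta> t n j)"
    using step.hyps step.prems[of k] by (subst kernel_P.simps) simp
  also have "\<dots> = (\<Sum>j=Suc k..n. kernel_P \<alpha> \<theta> t n j * kernel_A \<alpha> \<theta> t j (Suc k)) -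
                  (\<Sum>j=Suc k..n. kernel_P \<alpha> \<theta> t n j * kernel_A \<alpha> \<theta> t j k)"
    by (simp add: sum_subtractf[symmetric] algebra_simps)
  finally show ?case
    using step.IH step.hyps step.prems by (simp add: sum.atLeast_Suc_atMost)
qed


section \<open>The Mittag-Leffler function\<close>

definition mittag_leffler :: "real \<Rightarrow> real \<Rightarrow> real" where
  "mittag_leffler \<alpha> z = (\<Sum>k. z ^ k / Gamma (1 + real k * \<alpha>))"

end

theory Submission
  imports Defs
begin

text \<open>
  Testing the scheme with \<open>u\<^bsup>n-\<theta>\<^esup>\<close> drops the gradient term, and the claim becomes a Gronwall
  inequality for the numbers \<open>\<parallel>u\<^bsup>n\<^esup>\<parallel>\<close>.  Three properties of the Alikhanov kernels carry the argument.

  First, monotonicity.  Put \<open>\<phi>\<^sub>n(s) = \<omega>\<^bsub>1-\<alpha>\<^esub>(t\<^bsub>n-\<theta>\<^esub> - s)\<close>, which is increasing and convex in \<open>s\<close>.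
  The kernels interlace with the nodal values of \<open>\<phi>\<^sub>n\<close>: the kernel of the step ending at \<open>t\<^sub>k\<close> is at
  most \<open>\<phi>\<^sub>n(t\<^sub>k)\<close> and the kernel of the next step is at least \<open>\<phi>\<^sub>n(t\<^sub>k)\<close>
  (\<open>kernel_A_le_phi\<close>, \<open>phi_le_kernel_A\<close>).  For the last two steps the choice \<open>\<theta> = \<alpha>/2\<close> gives even the
  gap \<open>(1 - \<theta>) A\<^sub>1 \<le> (1 - 2\<theta>) A\<^sub>0\<close> (\<open>kernel_A_last_two\<close>).  By Abel summation these two facts yield the
  discrete energy inequality \<open>\<Sum> A \<nabla>(v\<^sup>2) \<le> 2 v\<^bsup>n-\<theta>\<^esup> (D v)\<^bsup>n-\<theta>\<^esup>\<close> (\<open>energy_inequality\<close>), first pointwise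
  in space and then integrated.

  Second, a lower bound.  The quadratic correction \<open>b\<close> eats up at most the fraction \<open>7/11\<close> of the mean
  value \<open>a\<close>, because \<open>\<rho> \<le> 7/4\<close> means \<open>\<rho>/(1 + \<rho>) \<le> 7/11\<close>.  Hence each kernel is at least \<open>4/11\<close> times
  the mean of \<open>\<omega>\<^bsub>1-\<alpha>\<^esub>(t\<^sub>n - s)\<close> over its step (\<open>kernel_A_ge\<close>).

  Third, duality.  The complementary kernels are nonnegative and invert the discrete derivative
  (\<open>kernel_P_inverts_frac_diff\<close>), so they act like a fractional integral of order \<open>\<alpha>\<close>.  Comparing with
  the continuous identity \<open>\<omega>\<^bsub>1-\<alpha>\<^esub> * \<omega>\<^sub>\<beta> = \<omega>\<^bsub>1-\<alpha>+\<beta>\<^esub>\<close> through the lower bound shows that they map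
  \<open>\<omega>\<^bsub>1-\<alpha>+\<beta>\<^esub>\<close> to at most \<open>(11/4)(7/4) \<omega>\<^bsub>1+\<beta>\<^esub>\<close> (\<open>kernel_P_sum_fractional_le\<close>).  Summing over the powers
  \<open>\<beta> = m\<alpha>\<close> makes \<open>E\<^sub>\<alpha>(\<mu> t\<^bsup>\<alpha>\<^esup>)\<close> a discrete supersolution (\<open>kernel_P_sum_mittag_leffler_le\<close>).

  The Gronwall inequality (\<open>discrete_gronwall\<close>) is then an induction on \<open>n\<close>.  It needs work only when
  \<open>v\<^sup>n\<close> exceeds all earlier values: then one factor of the quadratic inequality may be replaced by
  \<open>v\<^sup>n\<close> and cancelled, the step size condition absorbs the implicit term, and the supersolution
  dominates the remaining sum.  With \<open>\<Lambda> = 2\<kappa>\<^sub>+\<close> the rate that comes out is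
  \<open>2 (7/4) (11/4) \<Lambda> = 19.25 \<kappa>\<^sub>+\<close>, rounded up to \<open>20 \<kappa>\<^sub>+\<close>.  The second estimate follows from
  \<open>\<Sum> P \<omega>\<^bsub>1-\<alpha>\<^esub>(t\<^sub>j) \<le> 11/4\<close> (\<open>kernel_P_sum_omega_le\<close>), since \<open>2 (11/4) \<le> 6\<close>.
\<close>


section \<open>Moments of monotone functions over an interval\<close>

lemma has_integral_centered:
  fixes a b :: real
  assumes "a \<le> b"
  shows "((\<lambda>s. s - (a + b) / 2) has_integral 0) {a..b}"
proof -
  have "((\<lambda>s. s - (a + b) / 2) has_integral
      (b - (a + b) / 2)\<^sup>2 / 2 - (a - (a + b) / 2)\<^sup>2 / 2) {a..b}"
    using assms
    by (intro fundamental_theorem_of_calculus)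
       (auto intro!: derivative_eq_intros simp flip: has_real_derivative_iff_has_vector_derivative)
  then show ?thesis
    by (simp add: power2_eq_square field_simps)
qed

lemma has_integral_centered_id:
  fixes a b :: real
  assumes "a \<le> b"
  shows "((\<lambda>s. (s - (a + b) / 2) * s) has_integral (b - a) ^ 3 / 12) {a..b}"
proof -
  have "((\<lambda>s. (s - (a + b) / 2) * s) has_integral
      (b ^ 3 / 3 - (a + b) / 4 * b\<^sup>2) - (a ^ 3 / 3 - (a + b) / 4 * a\<^sup>2)) {a..b}"
    using assms
    by (intro fundamental_theorem_of_calculus)
       (auto intro!: derivative_eq_intros
             simp: power2_eq_square field_simps
             simp flip: has_real_derivative_iff_has_vector_derivative)
  moreover have "(b ^ 3 / 3 - (a + b) / 4 * b\<^sup>2) - (a ^ 3 / 3 - (a + b) / 4 * a\<^sup>2) = (b - a) ^ 3 / 12"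
    by (simp add: power2_eq_square power3_eq_cube field_simps)
  ultimately show ?thesis by metis
qed

text \<open>The linear weight has mean zero, so \<open>g\<close> may be replaced by its deviation from the midpoint value,
  which has the sign of the weight.\<close>
lemma centered_moment_nonneg:
  fixes g :: "real \<Rightarrow> real"
  assumes "a \<le> b" "continuous_on {a..b} g"
    and "\<And>x y. a \<le> x \<Longrightarrow> x \<le> y \<Longrightarrow> y \<le> b \<Longrightarrow> g x \<le> g y"
  shows "0 \<le> integral {a..b} (\<lambda>s. (s - (a + b) / 2) * g s)"
proof -
  let ?m = "(a + b) / 2"
  have "((\<lambda>s. (s - ?m) * g s) has_integral integral {a..b} (\<lambda>s. (s - ?m) * g s)) {a..b}"
    by (intro integrable_integral integrable_continuous_real continuous_intros assms)
  from has_integral_diff[OF this has_integral_mult_left[OF has_integral_centered[OF assms(1)], of "g ?m"]]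
  have "((\<lambda>s. (s - ?m) * (g s - g ?m)) has_integral integral {a..b} (\<lambda>s. (s - ?m) * g s)) {a..b}"
    by (simp add: algebra_simps)
  then show ?thesis
  proof (rule has_integral_nonneg)
    fix s assume "s \<in> {a..b}"
    then show "0 \<le> (s - ?m) * (g s - g ?m)"
      using assms(3)[of s ?m] assms(3)[of ?m s] assms(1)
      by (cases "s \<le> ?m") (auto intro: mult_nonneg_nonneg mult_nonpos_nonpos)
  qed
qed

text \<open>Subtracting \<open>g\<close> from a line of slope \<open>m\<close> leaves an increasing function.  This bounds the moment of
  a convex function by a tangent slope, without differentiating under the integral.\<close>
lemma centered_moment_le_of_slope:
  fixes g :: "real \<Rightarrow> real"
  assumes "a \<le> b" "continuous_on {a..b} g"
    and "\<And>x y. a \<le> x \<Longrightarrow> x \<le> y \<Longrightarrow> y \<le> b \<Longrightarrow> g y - g x \<le> m * (y - x)"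
  shows "integral {a..b} (\<lambda>s. (s - (a + b) / 2) * g s) \<le> m * (b - a) ^ 3 / 12"
proof -
  have "0 \<le> integral {a..b} (\<lambda>s. (s - (a + b) / 2) * (m * s - g s))"
    using assms by (intro centered_moment_nonneg continuous_intros) (auto simp: algebra_simps)
  also have "((\<lambda>s. (s - (a + b) / 2) * g s) has_integral
      integral {a..b} (\<lambda>s. (s - (a + b) / 2) * g s)) {a..b}"
    by (intro integrable_integral integrable_continuous_real continuous_intros assms)
  from has_integral_diff[OF has_integral_mult_right[OF has_integral_centered_id[OF assms(1)], of m] this]
  have "integral {a..b} (\<lambda>s. (s - (a + b) / 2) * (m * s - g s))
      = m * ((b - a) ^ 3 / 12) - integral {a..b} (\<lambda>s. (s - (a + b) / 2) * g s)"
    by (intro integral_unique) (simp add: right_diff_distrib mult.left_commute)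
  finally show ?thesis by simp
qed

text \<open>On \<open>{a..b}\<close> twice the weight is at most \<open>b - a\<close>; a constant \<open>c\<close> below \<open>g\<close> can be removed first
  since its moment vanishes.\<close>
lemma centered_moment_le_integral:
  fixes g :: "real \<Rightarrow> real"
  assumes "a \<le> b" "continuous_on {a..b} g"
    and "\<And>x. a \<le> x \<Longrightarrow> x \<le> b \<Longrightarrow> c \<le> g x"
  shows "2 * integral {a..b} (\<lambda>s. (s - (a + b) / 2) * g s)
    \<le> (b - a) * (integral {a..b} g - (b - a) * c)"
proof -
  let ?m = "(a + b) / 2"
  have 1: "((\<lambda>s. (s - ?m) * g s) has_integral integral {a..b} (\<lambda>s. (s - ?m) * g s)) {a..b}"
    by (intro integrable_integral integrable_continuous_real continuous_intros assms)
  have 2: "(g has_integral integral {a..b} g) {a..b}"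
    by (intro integrable_integral integrable_continuous_real assms)
  have 3: "((\<lambda>s. c) has_integral (b - a) * c) {a..b}"
    using has_integral_const_real[of c a b] assms(1) by simp
  have "0 \<le> (b - a) * (integral {a..b} g - (b - a) * c)
      - 2 * (integral {a..b} (\<lambda>s. (s - ?m) * g s) - 0 * c)"
  proof (rule has_integral_nonneg)
    show "((\<lambda>s. (b - a) * (g s - c) - 2 * ((s - ?m) * g s - (s - ?m) * c)) has_integral
      (b - a) * (integral {a..b} g - (b - a) * c)
      - 2 * (integral {a..b} (\<lambda>s. (s - ?m) * g s) - 0 * c)) {a..b}"
      by (intro has_integral_diff has_integral_mult_right has_integral_mult_left
          has_integral_centered 1 2 3 assms)
  next
    fix s assume s: "s \<in> {a..b}"
    have "(b - a) * (g s - c) - 2 * ((s - ?m) * g s - (s - ?m) * c) = 2 * (b - s) * (g s - c)"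
      by (simp add: field_simps)
    then show "0 \<le> (b - a) * (g s - c) - 2 * ((s - ?m) * g s - (s - ?m) * c)"
      using s assms(3)[of s] by simp
  qed
  then show ?thesis by simp
qed

lemma integral_le_endpoint_of_slope:
  fixes g :: "real \<Rightarrow> real"
  assumes "a \<le> b" "continuous_on {a..b} g"
    and "\<And>x. a \<le> x \<Longrightarrow> x \<le> b \<Longrightarrow> m * (b - x) \<le> g b - g x"
  shows "integral {a..b} g \<le> (b - a) * g b - m * (b - a)\<^sup>2 / 2"
proof -
  have "((\<lambda>s. g b - m * (b - s)) has_integral
      (g b * b + m * (b - b)\<^sup>2 / 2) - (g b * a + m * (b - a)\<^sup>2 / 2)) {a..b}"
    using assms(1)
    by (intro fundamental_theorem_of_calculus)
       (auto intro!: derivative_eq_intros simp: field_simps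
             simp flip: has_real_derivative_iff_has_vector_derivative)
  then have 1: "((\<lambda>s. g b - m * (b - s)) has_integral (b - a) * g b - m * (b - a)\<^sup>2 / 2) {a..b}"
    by (simp add: algebra_simps)
  show ?thesis
  proof (rule has_integral_le[OF _ 1])
    show "(g has_integral integral {a..b} g) {a..b}"
      by (intro integrable_integral integrable_continuous_real assms)
  next
    fix x assume "x \<in> {a..b}"
    then show "g x \<le> g b - m * (b - x)" using assms(3)[of x] by simp
  qed
qed

text \<open>The product \<open>(f s - f u) (g s - g u)\<close> is nowhere positive; integrate it over \<open>s\<close> and then over \<open>u\<close>.
  Monotonicity is required only in the open interval because the functions of interest have
  singularities at the end points.\<close>
lemma chebyshev_integral_inequality:
  fixes f g :: "real \<Rightarrow> real"
  assumes "a \<le> b" "f integrable_on {a..b}" "g integrable_on {a..b}"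
    "(\<lambda>s. f s * g s) integrable_on {a..b}"
    and f: "\<And>x y. a < x \<Longrightarrow> x \<le> y \<Longrightarrow> y < b \<Longrightarrow> f x \<le> f y"
    and g: "\<And>x y. a < x \<Longrightarrow> x \<le> y \<Longrightarrow> y < b \<Longrightarrow> g y \<le> g x"
  shows "(b - a) * integral {a..b} (\<lambda>s. f s * g s) \<le> integral {a..b} f * integral {a..b} g"
proof -
  let ?I = "{a<..<b}"
  define F G FG where "F = integral {a..b} f" and "G = integral {a..b} g"
    and "FG = integral {a..b} (\<lambda>s. f s * g s)"
  have F: "(f has_integral F) ?I" and G: "(g has_integral G) ?I"
    and FG: "((\<lambda>s. f s * g s) has_integral FG) ?I"
    using assms(2-4) unfolding F_def G_def FG_def by (simp_all add: integrable_integral flip: has_integral_Icc_iff_Ioo)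
  have c: "((\<lambda>s. c) has_integral c * (b - a)) ?I" for c :: real
    using has_integral_const_real[of c a b] assms(1)
    by (simp add: mult.commute flip: has_integral_Icc_iff_Ioo)
  have opp: "(f s - f u) * (g s - g u) \<le> 0" if "s \<in> ?I" "u \<in> ?I" for s u
    using that f[of s u] f[of u s] g[of s u] g[of u s]
    by (cases "s \<le> u") (auto intro: mult_nonpos_nonneg mult_nonneg_nonpos)
  \<comment> \<open>Integration over \<open>s\<close>; the next step integrates the result over \<open>u\<close>.\<close>
  have inner: "FG - f u * G - F * g u + f u * g u * (b - a) \<le> 0" if u: "u \<in> ?I" for u
  proof (rule has_integral_le[where g = "\<lambda>_. 0"])
    show "((\<lambda>s. f s * g s - f u * g s - f s * g u + f u * g u) has_integral
        FG - f u * G - F * g u + f u * g u * (b - a)) ?I"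
      by (intro has_integral_diff has_integral_add has_integral_mult_right has_integral_mult_left
          F G FG c)
    show "((\<lambda>_. 0::real) has_integral 0) ?I" by simp
    show "f s * g s - f u * g s - f s * g u + f u * g u \<le> 0" if "s \<in> ?I" for s
      using opp[OF that u] by (simp add: algebra_simps)
  qed
  have "FG * (b - a) - F * G - F * G + FG * (b - a) \<le> 0"
  proof (rule has_integral_le[where g = "\<lambda>_. 0"])
    show "((\<lambda>u. FG - f u * G - F * g u + f u * g u * (b - a)) has_integral
        FG * (b - a) - F * G - F * G + FG * (b - a)) ?I"
      by (intro has_integral_diff has_integral_add has_integral_mult_right has_integral_mult_left
          F G FG c)
    show "((\<lambda>_. 0::real) has_integral 0) ?I" by simp
  qed (use inner in auto)
  then show ?thesis by (simp add: F_def G_def FG_def algebra_simps)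
qed


section \<open>Power functions and their fractional integrals\<close>

lemma omega_nonneg: "0 < \<beta> \<Longrightarrow> 0 \<le> omega \<beta> s"
  by (simp add: omega_def)

lemma omega_pos: "0 < \<beta> \<Longrightarrow> 0 < s \<Longrightarrow> 0 < omega \<beta> s"
  by (simp add: omega_def)

lemma omega_antimono: "0 < \<beta> \<Longrightarrow> \<beta> \<le> 1 \<Longrightarrow> 0 < s \<Longrightarrow> s \<le> r \<Longrightarrow> omega \<beta> r \<le> omega \<beta> s"
  unfolding omega_def by (intro divide_right_mono powr_mono2') auto

lemma omega_mono: "1 \<le> \<beta> \<Longrightarrow> 0 \<le> s \<Longrightarrow> s \<le> r \<Longrightarrow> omega \<beta> s \<le> omega \<beta> r"
  unfolding omega_def by (intro divide_right_mono powr_mono2) auto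

lemma continuous_on_omega:
  assumes "continuous_on A g" "\<And>x. x \<in> A \<Longrightarrow> 0 < g x" "0 < \<beta>"
  shows "continuous_on A (\<lambda>x. omega \<beta> (g x))"
  unfolding omega_def using assms
  by (intro continuous_intros) (auto simp: Gamma_eq_zero_iff less_le elim!: nonpos_Ints_cases)

text \<open>Written with \<open>\<beta> + 1\<close>, the exponent is positive and continuity extends to the zeros of \<open>g\<close>.\<close>
lemma continuous_on_omega_Suc:
  assumes "continuous_on A g" "\<And>x. x \<in> A \<Longrightarrow> 0 \<le> g x" "0 < \<beta>"
  shows "continuous_on A (\<lambda>x. omega (\<beta> + 1) (g x))"
proof -
  have "Gamma (\<beta> + 1) \<noteq> 0"
    using Gamma_real_pos[of "\<beta> + 1"] assms(3) by linarith
  then show ?thesis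
    unfolding omega_def using assms
    by (intro continuous_on_divide continuous_on_powr' continuous_intros) auto
qed

lemma omega_Suc_has_real_derivative:
  assumes "0 < \<beta>" "0 < s"
  shows "(omega (\<beta> + 1) has_real_derivative omega \<beta> s) (at s)"
proof -
  have "Gamma \<beta> \<noteq> 0" using assms(1) Gamma_real_pos[of \<beta>] by linarith
  moreover have "Gamma (\<beta> + 1) = \<beta> * Gamma \<beta>"
    using assms(1) by (intro Gamma_plus1) (auto elim!: nonpos_Ints_cases)
  ultimately show ?thesis
    unfolding omega_def using assms
    by (auto intro!: derivative_eq_intros)
qed

lemma omega_Suc:
  assumes "0 < \<beta>" "0 < s"
  shows "\<beta> * omega (\<beta> + 1) s = s * omega \<beta> s"
proof -
  have "Gamma (\<beta> + 1) = \<beta> * Gamma \<beta>"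
    using assms(1) by (intro Gamma_plus1) (auto elim!: nonpos_Ints_cases)
  moreover have "s powr \<beta> = s * s powr (\<beta> - 1)"
    using assms(2) by (simp add: powr_diff)
  ultimately show ?thesis
    using assms by (simp add: omega_def)
qed

lemma has_integral_omega:
  assumes "0 < \<beta>" "0 \<le> a" "a \<le> b"
  shows "(omega \<beta> has_integral omega (\<beta> + 1) b - omega (\<beta> + 1) a) {a..b}"
  using assms
  by (intro fundamental_theorem_of_calculus_interior continuous_on_omega_Suc continuous_intros)
     (auto intro!: omega_Suc_has_real_derivative simp flip: has_real_derivative_iff_has_vector_derivative)

lemma has_integral_omega_reflected:
  assumes "0 < \<beta>" "a \<le> b" "b \<le> c"
  shows "((\<lambda>s. omega \<beta> (c - s)) has_integral omega (\<beta> + 1) (c - a) - omega (\<beta> + 1) (c - b)) {a..b}"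
proof -
  have "((\<lambda>s. omega \<beta> (c - s)) has_integral
      (- omega (\<beta> + 1) (c - b)) - (- omega (\<beta> + 1) (c - a))) {a..b}"
  proof (intro fundamental_theorem_of_calculus_interior assms)
    show "continuous_on {a..b} (\<lambda>s. - omega (\<beta> + 1) (c - s))"
      using assms by (intro continuous_intros continuous_on_omega_Suc) auto
  next
    fix s assume "s \<in> {a<..<b}"
    then have "((\<lambda>s. omega (\<beta> + 1) (c - s)) has_real_derivative omega \<beta> (c - s) * (-1)) (at s)"
      using assms
      by (intro DERIV_chain'[where g = "omega (\<beta> + 1)"] omega_Suc_has_real_derivative)
         (auto intro!: derivative_eq_intros)
    then show "((\<lambda>s. - omega (\<beta> + 1) (c - s)) has_vector_derivative omega \<beta> (c - s)) (at s)"
      by (auto intro!: derivative_eq_intros simp flip: has_real_derivative_iff_has_vector_derivative)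
  qed
  then show ?thesis by simp
qed

text \<open>The semigroup law of fractional integration: a rescaled Beta integral.\<close>
lemma omega_convolution:
  assumes "0 < \<beta>" "0 < \<gamma>" "0 < x"
  shows "((\<lambda>s. omega \<beta> (x - s) * omega \<gamma> s) has_integral omega (\<beta> + \<gamma>) x) {0..x}"
proof -
  have G: "Gamma \<beta> \<noteq> 0" "Gamma \<gamma> \<noteq> 0"
    using assms Gamma_real_pos[of \<beta>] Gamma_real_pos[of \<gamma>] by linarith+
  have "((\<lambda>s. ((1 / x) *\<^sub>R s + 0) powr (\<gamma> - 1) * (1 - ((1 / x) *\<^sub>R s + 0)) powr (\<beta> - 1)) has_integral
      Beta \<gamma> \<beta> /\<^sub>R (1 / x) ^ DIM(real)) (cbox ((0 - 0) /\<^sub>R (1 / x)) ((1 - 0) /\<^sub>R (1 / x)))"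
    using has_integral_Beta_real[of \<gamma> \<beta>] assms by (intro has_integral_affinity') auto
  then have "((\<lambda>s. (s / x) powr (\<gamma> - 1) * (1 - s / x) powr (\<beta> - 1)) has_integral Beta \<gamma> \<beta> * x) {0..x}"
    using assms by (simp add: mult.commute)
  from has_integral_mult_right[OF this, of "x powr (\<gamma> - 1) * x powr (\<beta> - 1) / (Gamma \<beta> * Gamma \<gamma>)"]
  have "((\<lambda>s. x powr (\<gamma> - 1) * x powr (\<beta> - 1) / (Gamma \<beta> * Gamma \<gamma>) *
      ((s / x) powr (\<gamma> - 1) * (1 - s / x) powr (\<beta> - 1))) has_integral
      x powr (\<gamma> - 1) * x powr (\<beta> - 1) / (Gamma \<beta> * Gamma \<gamma>) * (Beta \<gamma> \<beta> * x)) {0..x}" .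
  also have "x powr (\<gamma> - 1) * x powr (\<beta> - 1) / (Gamma \<beta> * Gamma \<gamma>) * (Beta \<gamma> \<beta> * x)
      = omega (\<beta> + \<gamma>) x"
  proof -
    have "x powr (\<gamma> - 1) * x powr (\<beta> - 1) * x = x powr (\<gamma> - 1) * x powr (\<beta> - 1) * x powr 1"
      using assms by simp
    also have "\<dots> = x powr (\<beta> + \<gamma> - 1)"
      by (simp only: flip: powr_add) (simp add: algebra_simps)
    finally have "x powr (\<gamma> - 1) * x powr (\<beta> - 1) * x = x powr (\<beta> + \<gamma> - 1)" .
    then show ?thesis
      using G by (simp add: omega_def Beta_def field_simps)
  qed
  finally show ?thesis
  proof (rule has_integral_eq[rotated])
    fix s assume s: "s \<in> {0..x}"
    have "1 - s / x = (x - s) / x" using assms by (simp add: field_simps)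
    then have "(s / x) powr (\<gamma> - 1) = s powr (\<gamma> - 1) / x powr (\<gamma> - 1)"
      "(1 - s / x) powr (\<beta> - 1) = (x - s) powr (\<beta> - 1) / x powr (\<beta> - 1)"
      using s assms by (simp_all add: powr_divide)
    then have "x powr (\<gamma> - 1) * x powr (\<beta> - 1) * ((s / x) powr (\<gamma> - 1) * (1 - s / x) powr (\<beta> - 1))
        = (x - s) powr (\<beta> - 1) * s powr (\<gamma> - 1)"
      using assms by simp
    then show "x powr (\<gamma> - 1) * x powr (\<beta> - 1) / (Gamma \<beta> * Gamma \<gamma>) *
        ((s / x) powr (\<gamma> - 1) * (1 - s / x) powr (\<beta> - 1)) = omega \<beta> (x - s) * omega \<gamma> s"
      by (simp add: omega_def)
  qed
qed

text \<open>Convexity of \<open>s \<mapsto> \<omega>\<^sub>\<beta>(c - s)\<close>, in the form in which it is used: the derivative \<open>m\<close> at \<open>p\<close> separates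
  the slopes of chords to the left of \<open>p\<close> from those to the right.\<close>
lemma omega_reflected_slope:
  assumes "0 < \<beta>" "\<beta> < 1" "p < c"
  defines "m \<equiv> (1 - \<beta>) * (c - p) powr (\<beta> - 2) / Gamma \<beta>"
  shows "x \<le> y \<Longrightarrow> y \<le> p \<Longrightarrow> omega \<beta> (c - y) - omega \<beta> (c - x) \<le> m * (y - x)"
    and "p \<le> x \<Longrightarrow> x \<le> y \<Longrightarrow> y < c \<Longrightarrow> m * (y - x) \<le> omega \<beta> (c - y) - omega \<beta> (c - x)"
proof -
  define D where "D s = (1 - \<beta>) * (c - s) powr (\<beta> - 2) / Gamma \<beta>" for s
  have D: "((\<lambda>s. omega \<beta> (c - s)) has_real_derivative D s) (at s)" if "s < c" for s
    unfolding omega_def D_def using that assms(1)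
    by (auto intro!: derivative_eq_intros simp: Gamma_real_pos less_imp_neq[symmetric] field_simps)
  have mono: "D s \<le> D r" if "s \<le> r" "r < c" for s r
    unfolding D_def using that assms by (intro divide_right_mono mult_left_mono powr_mono2') auto
  have mvt: "\<exists>z. x < z \<and> z < y \<and> omega \<beta> (c - y) - omega \<beta> (c - x) = (y - x) * D z"
    if "x < y" "y < c" for x y
    using MVT2[OF that(1), of "\<lambda>s. omega \<beta> (c - s)" D] D that by force
  show "omega \<beta> (c - y) - omega \<beta> (c - x) \<le> m * (y - x)" if xy: "x \<le> y" "y \<le> p"
  proof (cases "x < y")
    case True
    then obtain z where z: "x < z" "z < y" "omega \<beta> (c - y) - omega \<beta> (c - x) = (y - x) * D z"
      using mvt[of x y] xy assms(3) by fastforce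
    moreover have "D z \<le> m"
      using mono[of z p] z xy assms unfolding D_def m_def by simp
    ultimately show ?thesis using True by (simp add: mult.commute)
  qed (use xy in auto)
  show "m * (y - x) \<le> omega \<beta> (c - y) - omega \<beta> (c - x)" if xy: "p \<le> x" "x \<le> y" "y < c"
  proof (cases "x < y")
    case True
    then obtain z where z: "x < z" "z < y" "omega \<beta> (c - y) - omega \<beta> (c - x) = (y - x) * D z"
      using mvt[of x y] xy assms(3) by fastforce
    moreover have "m \<le> D z"
      using mono[of p z] z xy assms unfolding D_def m_def by simp
    ultimately show ?thesis using True by (simp add: mult.commute)
  qed (use xy in auto)
qed


section \<open>Finite sums\<close>

text \<open>Abel summation, with the terms \<open>(c (k + 1) - c k) y k\<close> and \<open>c 1 * y 0\<close> discarded.\<close>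
lemma sum_increasing_weights_le:
  fixes c y :: "nat \<Rightarrow> real"
  assumes "1 \<le> m" "\<And>k. 1 \<le> k \<Longrightarrow> k \<le> m \<Longrightarrow> 0 \<le> c k"
    "\<And>k. 1 \<le> k \<Longrightarrow> k < m \<Longrightarrow> c k \<le> c (k + 1)" "\<And>k. k \<le> m \<Longrightarrow> 0 \<le> y k"
  shows "(\<Sum>k=1..m. c k * (y k - y (k - 1))) \<le> c m * y m"
  using assms
proof (induction m rule: nat_induct_at_least)
  case base
  then show ?case by (simp add: algebra_simps)
next
  case (Suc m)
  have "(\<Sum>k=1..Suc m. c k * (y k - y (k - 1))) \<le> c m * y m + c (Suc m) * (y (Suc m) - y m)"
    using Suc.IH Suc.prems by simp
  also have "\<dots> \<le> c (Suc m) * y m + c (Suc m) * (y (Suc m) - y m)"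
    using Suc.hyps Suc.prems(2)[of m] Suc.prems(3)[of m] by (intro add_right_mono mult_right_mono) auto
  finally show ?case by (simp add: algebra_simps)
qed

lemma sum_triangle_swap:
  fixes g :: "nat \<Rightarrow> nat \<Rightarrow> real"
  shows "(\<Sum>j=1..n. \<Sum>k=1..j. g j k) = (\<Sum>k=1..n. \<Sum>j=k..n. g j k)"
proof -
  have "(\<Sum>j=1..n. \<Sum>k=1..j. g j k) = (\<Sum>j=1..n. sum (g j) {k \<in> {1..n}. k \<le> j})"
    by (intro sum.cong) auto
  also have "\<dots> = (\<Sum>k=1..n. \<Sum>j\<in>{j \<in> {1..n}. k \<le> j}. g j k)"
    by (rule sum.swap_restrict) auto
  also have "\<dots> = (\<Sum>k=1..n. \<Sum>j=k..n. g j k)"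
    by (intro sum.cong) auto
  finally show ?thesis .
qed


section \<open>The Alikhanov kernels on a grid with mildly decreasing steps\<close>

locale alikhanov_grid =
  fixes \<alpha> \<theta> :: real and t :: "nat \<Rightarrow> real" and N :: nat
  assumes alpha: "0 < \<alpha>" "\<alpha> < 1" and theta: "\<theta> = \<alpha> / 2"
    and t_0: "t 0 = 0"
    and grid: "\<And>k. 1 \<le> k \<Longrightarrow> k \<le> N \<Longrightarrow> t (k - 1) < t k"
    and ratio: "\<And>k. 1 \<le> k \<Longrightarrow> k \<le> N - 1 \<Longrightarrow> step_ratio t k \<le> 7 / 4"
begin

abbreviation "\<tau> \<equiv> time_step t"
abbreviation "a \<equiv> coef_a \<alpha> \<theta> t"
abbreviation "b \<equiv> coef_b \<alpha> \<theta> t"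
abbreviation "A \<equiv> kernel_A \<alpha> \<theta> t"
abbreviation "P \<equiv> kernel_P \<alpha> \<theta> t"
abbreviation "\<sigma> \<equiv> offset \<theta> t"

definition \<phi> :: "nat \<Rightarrow> real \<Rightarrow> real" where
  "\<phi> n = (\<lambda>s. omega (1 - \<alpha>) (\<sigma> n - s))"

text \<open>Setting the correction inherited from the preceding step to zero for \<open>k = 1\<close> merges all branches
  of \<open>kernel_A\<close> into the single formula \<open>kernel_A_eq\<close>.\<close>
definition past_correction :: "nat \<Rightarrow> nat \<Rightarrow> real" where
  "past_correction n k = (if 2 \<le> k then step_ratio t (k - 1) * b n (k - 1) else 0)"

lemma theta_bounds: "0 < \<theta>" "\<theta> < 1 / 2" "1 - \<alpha> = 1 - 2 * \<theta>" "1 - \<alpha> \<le> 1 - \<theta>"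
  using alpha theta by linarith+

lemma t_diff: "t k - t (k - Suc 0) = \<tau> k"
  by (simp add: time_step_def)

lemma tau_pos: "1 \<le> k \<Longrightarrow> k \<le> N \<Longrightarrow> 0 < \<tau> k"
  using grid[of k] by (simp add: time_step_def)

lemma tau_le: "1 \<le> k \<Longrightarrow> k < N \<Longrightarrow> \<tau> k \<le> 7 / 4 * \<tau> (k + 1)"
  using ratio[of k] tau_pos[of "k + 1"] by (simp add: step_ratio_def field_simps)

lemma t_mono: "i \<le> j \<Longrightarrow> j \<le> N \<Longrightarrow> t i \<le> t j"
proof (induction rule: dec_induct)
  case (step m)
  then show ?case using grid[of "Suc m"] by simp
qed simp

lemma t_nonneg: "j \<le> N \<Longrightarrow> 0 \<le> t j"
  using t_mono[of 0 j] t_0 by simp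

lemma t_pos: "1 \<le> j \<Longrightarrow> j \<le> N \<Longrightarrow> 0 < t j"
  by (rule le_less_trans[OF t_nonneg[of "j - 1"] grid]) auto

lemma sigma_minus: "\<sigma> n - t (n - 1) = (1 - \<theta>) * \<tau> n"
  by (simp add: offset_def time_step_def algebra_simps)

lemma sigma_gt: "1 \<le> n \<Longrightarrow> n \<le> N \<Longrightarrow> t (n - 1) < \<sigma> n"
  using sigma_minus[of n] tau_pos[of n] alpha theta
    mult_pos_pos[of "1 - \<theta>" "\<tau> n"] by linarith

lemma sigma_lt: "1 \<le> n \<Longrightarrow> n \<le> N \<Longrightarrow> \<sigma> n < t n"
proof -
  assume "1 \<le> n" "n \<le> N"
  then have "0 < \<theta> * \<tau> n" using tau_pos[of n] alpha theta by simp
  then show ?thesis by (simp add: offset_def time_step_def algebra_simps)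
qed

lemma t_lt_sigma: "k < n \<Longrightarrow> n \<le> N \<Longrightarrow> t k < \<sigma> n"
  by (rule le_less_trans[OF t_mono[of k "n - 1"] sigma_gt]) auto

lemma phi_pos: "s < \<sigma> n \<Longrightarrow> 0 < \<phi> n s"
  using alpha by (simp add: \<phi>_def omega_pos)

lemma phi_mono: "s \<le> r \<Longrightarrow> r < \<sigma> n \<Longrightarrow> \<phi> n s \<le> \<phi> n r"
  using alpha by (simp add: \<phi>_def omega_antimono)

lemma phi_continuous:
  assumes "k < n" "n \<le> N"
  shows "continuous_on {x..t k} (\<phi> n)"
  unfolding \<phi>_def using assms t_lt_sigma[OF assms] alpha
  by (intro continuous_on_omega continuous_intros) auto

lemma coef_a_inner:
  assumes "1 \<le> k" "k < n" "n \<le> N"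
  shows "\<tau> k * a n k = integral {t (k - 1)..t k} (\<phi> n)"
proof -
  have "min (t k) (\<sigma> n) = t k" using t_lt_sigma[of k n] assms by simp
  then show ?thesis using tau_pos[of k] assms by (simp add: coef_a_def \<phi>_def)
qed

lemma coef_a_last:
  assumes "1 \<le> n" "n \<le> N"
  shows "\<tau> n * a n n = omega (2 - \<alpha>) ((1 - \<theta>) * \<tau> n)"
proof -
  have "min (t n) (\<sigma> n) = \<sigma> n" using sigma_lt[of n] assms by simp
  moreover have "((\<lambda>s. omega (1 - \<alpha>) (\<sigma> n - s)) has_integral
      omega (1 - \<alpha> + 1) (\<sigma> n - t (n - 1)) - omega (1 - \<alpha> + 1) (\<sigma> n - \<sigma> n)) {t (n - 1)..\<sigma> n}"
    using sigma_gt[of n] assms alpha by (intro has_integral_omega_reflected) auto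
  then have "integral {t (n - 1)..\<sigma> n} (\<lambda>s. omega (1 - \<alpha>) (\<sigma> n - s)) = omega (2 - \<alpha>) ((1 - \<theta>) * \<tau> n)"
    by (simp only: sigma_minus integral_unique) (simp add: omega_def)
  ultimately show ?thesis using tau_pos[of n] assms by (simp add: coef_a_def)
qed

lemma coef_b_eq:
  assumes "1 \<le> k" "k < n" "n \<le> N"
  shows "\<tau> k * (\<tau> k + \<tau> (k + 1)) * b n k =
    2 * integral {t (k - 1)..t k} (\<lambda>s. (s - (t (k - 1) + t k) / 2) * \<phi> n s)"
  using tau_pos[of k] tau_pos[of "k + 1"] assms by (simp add: coef_b_def \<phi>_def)

lemma coef_b_nonneg:
  assumes "1 \<le> k" "k < n" "n \<le> N"
  shows "0 \<le> b n k"
proof -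
  have "0 \<le> integral {t (k - 1)..t k} (\<lambda>s. (s - (t (k - 1) + t k) / 2) * \<phi> n s)"
    using grid[of k] assms t_lt_sigma[of k n]
    by (intro centered_moment_nonneg phi_continuous phi_mono) auto
  then have "0 \<le> \<tau> k * (\<tau> k + \<tau> (k + 1)) * b n k" using coef_b_eq[OF assms] by simp
  moreover have "0 < \<tau> k * (\<tau> k + \<tau> (k + 1))"
    using tau_pos[of k] tau_pos[of "k + 1"] assms by simp
  ultimately show ?thesis by (simp add: zero_le_mult_iff)
qed

text \<open>Common source of the two bounds on \<open>b\<close>: \<open>c = 0\<close> gives the fraction \<open>7/11\<close> of \<open>a\<close>, and
  \<open>c = \<phi> n (t (k - 1))\<close> the comparison with the nodal value at the left end point.\<close>
lemma coef_b_le_excess: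
  assumes "1 \<le> k" "k < n" "n \<le> N"
    and "\<And>s. t (k - 1) \<le> s \<Longrightarrow> s \<le> t k \<Longrightarrow> c \<le> \<phi> n s"
  shows "(\<tau> k + \<tau> (k + 1)) * b n k \<le> \<tau> k * (a n k - c)"
proof -
  have "\<tau> k * ((\<tau> k + \<tau> (k + 1)) * b n k) \<le> (t k - t (k - 1)) * (integral {t (k - 1)..t k} (\<phi> n) - (t k - t (k - 1)) * c)"
    using centered_moment_le_integral[of "t (k - 1)" "t k" "\<phi> n" c] grid[of k]
      phi_continuous[of k n] coef_b_eq[of k n] assms by (simp add: mult.assoc)
  also have "\<dots> = \<tau> k * (\<tau> k * (a n k - c))"
    using coef_a_inner[of k n] assms by (simp add: right_diff_distrib t_diff)
  finally show ?thesis using tau_pos[of k] assms by simp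
qed

lemma coef_b_le:
  assumes "1 \<le> k" "k < n" "n \<le> N"
  shows "b n k \<le> 7 / 11 * a n k"
proof -
  have "11 / 7 * \<tau> k * b n k \<le> (\<tau> k + \<tau> (k + 1)) * b n k"
    using tau_le[of k] coef_b_nonneg[OF assms] assms by (intro mult_right_mono) auto
  also have "\<dots> \<le> \<tau> k * (a n k - 0)"
    using assms alpha by (intro coef_b_le_excess) (auto simp: \<phi>_def omega_nonneg)
  finally have "\<tau> k * (11 / 7 * b n k) \<le> \<tau> k * a n k" by simp
  then show ?thesis using tau_pos[of k] assms by simp
qed

lemma coef_b_le_gap:
  assumes "1 \<le> k" "k < n" "n \<le> N"
  shows "b n k \<le> a n k - \<phi> n (t (k - 1))"
proof -
  have "\<tau> k * b n k \<le> (\<tau> k + \<tau> (k + 1)) * b n k"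
    using tau_pos[of "k + 1"] coef_b_nonneg[OF assms] assms by (intro mult_right_mono) auto
  also have "\<dots> \<le> \<tau> k * (a n k - \<phi> n (t (k - 1)))"
    using assms t_lt_sigma[of k n] by (intro coef_b_le_excess phi_mono) auto
  finally show ?thesis using tau_pos[of k] assms by simp
qed

lemma past_correction_nonneg:
  assumes "1 \<le> k" "k \<le> n" "n \<le> N"
  shows "0 \<le> past_correction n k"
proof (cases "2 \<le> k")
  case True
  then have "0 \<le> b n (k - 1)" "0 < \<tau> (k - 1)" "0 < \<tau> k"
    using coef_b_nonneg[of "k - 1" n] tau_pos[of "k - 1"] tau_pos[of k] assms by auto
  then show ?thesis by (simp add: past_correction_def step_ratio_def)
qed (simp add: past_correction_def)

text \<open>Let \<open>m\<close> be the slope of \<open>\<phi> n\<close> at the common node \<open>t (k - 1)\<close> and write \<open>x\<close>, \<open>y\<close> for the lengths of the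
  steps to its left and right.  By convexity the correction from the left is at most that of a line
  of slope \<open>m\<close>, namely \<open>m x\<^sup>3 / (6 y (x + y))\<close>, while the gap on the right is at least \<open>m y / 2\<close>.  The claim
  reduces to \<open>x\<^sup>3 \<le> 3 y\<^sup>2 (x + y)\<close>, which follows from \<open>x \<le> 7/4 y\<close> since \<open>(7/4)\<^sup>2 = 3 + 1/16\<close>.\<close>
lemma past_correction_le_gap:
  assumes "1 \<le> k" "k < n" "n \<le> N"
  shows "past_correction n k \<le> \<phi> n (t k) - a n k"
proof -
  define p where "p = t (k - 1)"
  define m where "m = (1 - (1 - \<alpha>)) * (\<sigma> n - p) powr (1 - \<alpha> - 2) / Gamma (1 - \<alpha>)"
  have p: "p < \<sigma> n" unfolding p_def using t_lt_sigma[of "k - 1" n] assms by simp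
  have below: "\<phi> n y - \<phi> n x \<le> m * (y - x)" if "x \<le> y" "y \<le> p" for x y
    using omega_reflected_slope(1)[of "1 - \<alpha>" p "\<sigma> n" x y] that p alpha by (simp add: \<phi>_def m_def)
  have above: "m * (y - x) \<le> \<phi> n y - \<phi> n x" if "p \<le> x" "x \<le> y" "y < \<sigma> n" for x y
    using omega_reflected_slope(2)[of "1 - \<alpha>" p "\<sigma> n" x y] that p alpha by (simp add: \<phi>_def m_def)
  have m: "0 \<le> m" unfolding m_def using alpha by (auto intro!: divide_nonneg_nonneg)
  have tk: "0 < \<tau> k" using tau_pos assms by simp
  have "integral {p..t k} (\<phi> n) \<le> (t k - p) * \<phi> n (t k) - m * (t k - p)\<^sup>2 / 2"
    using grid[of k] assms t_lt_sigma[of k n]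
    by (intro integral_le_endpoint_of_slope phi_continuous above) (auto simp: p_def)
  then have "\<tau> k * a n k \<le> \<tau> k * \<phi> n (t k) - m * (\<tau> k)\<^sup>2 / 2"
    using assms coef_a_inner[of k n] by (simp add: p_def t_diff)
  also have "\<dots> = \<tau> k * (\<phi> n (t k) - m * \<tau> k / 2)" by (simp add: power2_eq_square algebra_simps)
  finally have a: "a n k \<le> \<phi> n (t k) - m * \<tau> k / 2" using tk by simp
  show ?thesis
  proof (cases "2 \<le> k")
    case False
    have "0 \<le> m * \<tau> k / 2" using m tk by simp
    then show ?thesis using False a by (simp add: past_correction_def)
  next
    case True
    define x y where "x = \<tau> (k - 1)" and "y = \<tau> k"
    have x: "0 < x" "0 < y" unfolding x_def y_def using tau_pos assms True by auto
    have xy: "x \<le> 7 / 4 * y"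
      using tau_le[of "k - 1"] assms True by (simp add: x_def y_def)
    have "integral {t (k - 1 - 1)..t (k - 1)} (\<lambda>s. (s - (t (k - 1 - 1) + t (k - 1)) / 2) * \<phi> n s)
        \<le> m * (t (k - 1) - t (k - 1 - 1)) ^ 3 / 12"
      using t_mono[of "k - 1 - 1" "k - 1"] assms True
      by (intro centered_moment_le_of_slope phi_continuous below) (auto simp: p_def)
    then have "x * (x + y) * b n (k - 1) \<le> m * x ^ 3 / 6"
      using coef_b_eq[of "k - 1" n] assms True by (simp add: x_def y_def time_step_def)
    then have "x * ((x + y) * b n (k - 1)) \<le> x * (m * x\<^sup>2 / 6)"
      by (simp add: power3_eq_cube power2_eq_square algebra_simps)
    then have "(x + y) * b n (k - 1) \<le> m * x\<^sup>2 / 6" using x by simp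
    then have "b n (k - 1) \<le> m * x\<^sup>2 / (6 * (x + y))" using x by (simp add: field_simps)
    then have "past_correction n k \<le> x / y * (m * x\<^sup>2 / (6 * (x + y)))"
      using True x mult_left_mono[of "b n (k - 1)" "m * x\<^sup>2 / (6 * (x + y))" "x / y"]
      by (simp add: past_correction_def step_ratio_def x_def y_def)
    also have "\<dots> = m * (x ^ 3 / (6 * y * (x + y)))"
      using x by (simp add: power3_eq_cube power2_eq_square field_simps)
    also have "\<dots> \<le> m * (y / 2)"
    proof (intro mult_left_mono m)
      have "x * x \<le> 7 / 4 * y * (7 / 4 * y)" using xy x by (intro mult_mono) auto
      then have "x * (x * x) \<le> x * (49 / 16 * (y * y))" using x by (intro mult_left_mono) auto
      also have "\<dots> = 3 * (y * y) * x + (y * y) * (x / 16)" by simp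
      also have "\<dots> \<le> 3 * (y * y) * x + (y * y) * (3 * y)"
        using x xy by (intro add_left_mono mult_left_mono) auto
      finally have "x ^ 3 \<le> 3 * y * y * (x + y)"
        by (simp add: power3_eq_cube algebra_simps)
      then have "x ^ 3 \<le> y / 2 * (6 * y * (x + y))" by simp
      moreover have "0 < 6 * y * (x + y)" using x by simp
      ultimately show "x ^ 3 / (6 * y * (x + y)) \<le> y / 2"
        by (simp only: pos_divide_le_eq)
    qed
    finally show ?thesis using a by (simp add: y_def)
  qed
qed

lemma kernel_A_eq:
  assumes "1 \<le> k" "k \<le> n"
  shows "A n k = a n k + past_correction n k - (if k < n then b n k else 0)"
  using assms by (cases "k = 1") (auto simp: kernel_A_def past_correction_def)

text \<open>The inherited correction stays below the gap between the mean \<open>a\<close> and the nodal value on its right,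
  and \<open>b\<close> stays below the gap to the nodal value on its left.  Hence \<open>\<phi> n (t k)\<close> separates the kernels
  of the steps \<open>k\<close> and \<open>k + 1\<close>.\<close>
lemma kernel_A_le_phi:
  assumes "1 \<le> k" "k < n" "n \<le> N"
  shows "A n k \<le> \<phi> n (t k)"
  using kernel_A_eq[of k n] past_correction_le_gap[of k n] coef_b_nonneg[of k n] assms by simp

lemma phi_le_kernel_A:
  assumes "1 \<le> k" "k < n" "n \<le> N"
  shows "\<phi> n (t (k - 1)) \<le> A n k"
  using kernel_A_eq[of k n] past_correction_nonneg[of k n] coef_b_le_gap[of k n] assms
  by simp

text \<open>The integral in the last coefficient \<open>a\<close> is explicit, and \<open>(1 - \<alpha>) a n n = (1 - \<theta>) \<phi> n (t (n - 1))\<close>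
  holds exactly.\<close>
lemma kernel_A_last_ge_phi:
  assumes "1 \<le> n" "n \<le> N"
  shows "(1 - \<theta>) * \<phi> n (t (n - 1)) \<le> (1 - \<alpha>) * A n n"
proof -
  have th: "0 < 1 - \<theta>" using alpha theta by simp
  have tn: "0 < \<tau> n" using tau_pos assms by simp
  have "\<tau> n * ((1 - \<alpha>) * a n n) = (1 - \<alpha>) * omega (1 - \<alpha> + 1) ((1 - \<theta>) * \<tau> n)"
    using coef_a_last[OF assms] by simp
  also have "\<dots> = \<tau> n * ((1 - \<theta>) * \<phi> n (t (n - 1)))"
    unfolding \<phi>_def sigma_minus using th tn alpha by (subst omega_Suc) auto
  finally have "(1 - \<alpha>) * a n n = (1 - \<theta>) * \<phi> n (t (n - 1))" using tn by simp
  moreover have "0 \<le> (1 - \<alpha>) * past_correction n n"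
    using past_correction_nonneg[of n n] assms alpha by simp
  ultimately show ?thesis using assms by (simp add: kernel_A_eq algebra_simps)
qed

text \<open>Stronger than monotonicity by the factor \<open>(1 - \<alpha>) / (1 - \<theta>)\<close>; the energy inequality needs this
  surplus because the test value \<open>v\<^bsup>n-\<theta>\<^esup>\<close> is not \<open>v\<^sup>n\<close>.\<close>
lemma kernel_A_last_two:
  assumes "2 \<le> n" "n \<le> N"
  shows "(1 - \<theta>) * A n (n - 1) \<le> (1 - \<alpha>) * A n n"
proof -
  have "(1 - \<theta>) * A n (n - 1) \<le> (1 - \<theta>) * \<phi> n (t (n - 1))"
    using kernel_A_le_phi[of "n - 1" n] assms alpha theta by (intro mult_left_mono) auto
  then show ?thesis using kernel_A_last_ge_phi[of n] assms by simp
qed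

text \<open>For \<open>k < n\<close> the factor \<open>4/11 = 1 - 7/11\<close> is what remains after subtracting \<open>b\<close>.  For \<open>k = n\<close> nothing is
  subtracted, but the integral stops short of \<open>t n\<close>, which costs only a factor
  \<open>(1 - \<theta>)\<^bsup>1-\<alpha>\<^esup> \<ge> 1/2\<close>.\<close>
lemma kernel_A_ge:
  assumes "1 \<le> k" "k \<le> n" "n \<le> N"
  shows "4 / 11 * integral {t (k - 1)..t k} (\<lambda>s. omega (1 - \<alpha>) (t n - s)) \<le> \<tau> k * A n k"
proof (cases "k < n")
  case True
  have tk: "0 < \<tau> k" using tau_pos assms by simp
  have "integral {t (k - 1)..t k} (\<lambda>s. omega (1 - \<alpha>) (t n - s)) \<le> integral {t (k - 1)..t k} (\<phi> n)"
  proof (rule integral_le)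
    show "(\<lambda>s. omega (1 - \<alpha>) (t n - s)) integrable_on {t (k - 1)..t k}"
      using has_integral_omega_reflected[of "1 - \<alpha>" "t (k - 1)" "t k" "t n"] grid[of k]
        t_mono[of k n] assms alpha by (auto simp: integrable_on_def)
    show "\<phi> n integrable_on {t (k - 1)..t k}"
      using True assms by (intro integrable_continuous_real phi_continuous)
    show "omega (1 - \<alpha>) (t n - s) \<le> \<phi> n s" if "s \<in> {t (k - 1)..t k}" for s
      unfolding \<phi>_def using that t_lt_sigma[of k n] sigma_lt[of n] True assms alpha
      by (intro omega_antimono) auto
  qed
  also have "\<dots> = \<tau> k * a n k" using coef_a_inner True assms by simp
  finally have "4 / 11 * integral {t (k - 1)..t k} (\<lambda>s. omega (1 - \<alpha>) (t n - s)) \<le> \<tau> k * (4 / 11 * a n k)"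
    by simp
  also have "\<dots> \<le> \<tau> k * A n k"
    using coef_b_le[of k n] kernel_A_eq[of k n] past_correction_nonneg[of k n] True assms tk
    by (intro mult_left_mono) auto
  finally show ?thesis .
next
  case False
  then have [simp]: "k = n" using assms by simp
  have tn: "0 < \<tau> n" using tau_pos assms by simp
  have "integral {t (n - 1)..t n} (\<lambda>s. omega (1 - \<alpha>) (t n - s)) = omega (2 - \<alpha>) (\<tau> n)"
  proof -
    have "integral {t (n - 1)..t n} (\<lambda>s. omega (1 - \<alpha>) (t n - s))
        = omega (1 - \<alpha> + 1) (t n - t (n - 1)) - omega (1 - \<alpha> + 1) (t n - t n)"
      using grid[of n] assms alpha
      by (intro integral_unique has_integral_omega_reflected) auto
    then show ?thesis by (simp add: time_step_def omega_def)
  qed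
  moreover have "1 / 2 * omega (2 - \<alpha>) (\<tau> n) \<le> omega (2 - \<alpha>) ((1 - \<theta>) * \<tau> n)"
  proof -
    have "1 - \<theta> = (1 - \<theta>) powr 1" using alpha theta by simp
    also have "\<dots> \<le> (1 - \<theta>) powr (1 - \<alpha>)"
      using alpha theta by (intro powr_mono') auto
    finally have "1 / 2 \<le> (1 - \<theta>) powr (1 - \<alpha>)" using theta_bounds by linarith
    then have "1 / 2 * (\<tau> n powr (1 - \<alpha>)) \<le> (1 - \<theta>) powr (1 - \<alpha>) * \<tau> n powr (1 - \<alpha>)"
      by (intro mult_right_mono) auto
    also have "\<dots> = ((1 - \<theta>) * \<tau> n) powr (1 - \<alpha>)"
      using alpha theta tn by (simp add: powr_mult)
    finally have "1 / 2 * \<tau> n powr (1 - \<alpha>) / Gamma (2 - \<alpha>)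
        \<le> ((1 - \<theta>) * \<tau> n) powr (1 - \<alpha>) / Gamma (2 - \<alpha>)"
      using alpha by (intro divide_right_mono) auto
    then show ?thesis by (simp add: omega_def)
  qed
  moreover have "omega (2 - \<alpha>) ((1 - \<theta>) * \<tau> n) \<le> \<tau> n * A n n"
    using coef_a_last[of n] kernel_A_eq[of n n] past_correction_nonneg[of n n] assms tn
    by (simp add: distrib_left)
  moreover have "0 \<le> omega (2 - \<alpha>) (\<tau> n)" using alpha by (simp add: omega_nonneg)
  ultimately show ?thesis by simp
qed

lemma kernel_A_pos:
  assumes "1 \<le> k" "k \<le> n" "n \<le> N"
  shows "0 < A n k"
proof (cases "k < n")
  case True
  have "0 < \<phi> n (t (k - 1))" using assms t_lt_sigma[of "k - 1" n] by (intro phi_pos) auto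
  then show ?thesis using phi_le_kernel_A[of k n] True assms by simp
next
  case False
  have "0 < (1 - \<theta>) * \<phi> n (t (n - 1))"
    using assms sigma_gt[of n] alpha theta phi_pos[of "t (n - 1)" n] by (intro mult_pos_pos) auto
  also have "\<dots> \<le> (1 - \<alpha>) * A n n" using assms by (intro kernel_A_last_ge_phi) auto
  finally show ?thesis using False alpha assms by (simp add: zero_less_mult_iff)
qed

lemma kernel_A_mono:
  assumes "1 \<le> k" "k < n" "n \<le> N"
  shows "A n k \<le> A n (k + 1)"
proof (cases "k + 1 < n")
  case True
  then show ?thesis using kernel_A_le_phi[of k n] phi_le_kernel_A[of "k + 1" n] assms by simp
next
  case False
  then have [simp]: "n = k + 1" using assms by simp
  have "(1 - \<theta>) * A n k \<le> (1 - \<alpha>) * A n n"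
    using kernel_A_last_two[of n] assms by simp
  also have "\<dots> \<le> (1 - \<theta>) * A n n"
    using kernel_A_pos[of n n] assms theta_bounds by (intro mult_right_mono) auto
  finally show ?thesis using theta_bounds by simp
qed


section \<open>The energy inequality\<close>

text \<open>With \<open>w = v\<^bsup>n-\<theta>\<^esup>\<close>, completing squares turns each term into an increment of \<open>(v\<^sup>k - w)\<^sup>2\<close>, and summation by
  parts against the increasing kernels leaves only the last two squares.  Both are multiples of
  \<open>\<delta>\<^sup>2\<close>, where \<open>\<delta> = v\<^sup>n - v\<^bsup>n-1\<^esup>\<close>, and \<open>kernel_A_last_two\<close> makes their combination nonpositive.\<close>
lemma energy_inequality:
  assumes "1 \<le> n" "n \<le> N"
  shows "frac_diff \<alpha> \<theta> t (\<lambda>k. (v k)\<^sup>2) n \<le> 2 * (offset \<theta> v n * frac_diff \<alpha> \<theta> t v n)"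
proof -
  define w where "w = offset \<theta> v n"
  define d where "d k = (v k - w)\<^sup>2" for k
  define \<delta> where "\<delta> = v n - v (n - 1)"
  have "v n - w = \<theta> * \<delta>" "v (n - 1) - w = - ((1 - \<theta>) * \<delta>)"
    unfolding w_def \<delta>_def offset_def by (simp_all add: algebra_simps)
  then have d: "d n = \<theta>\<^sup>2 * \<delta>\<^sup>2" "d (n - 1) = (1 - \<theta>)\<^sup>2 * \<delta>\<^sup>2"
    unfolding d_def by (simp_all add: power_mult_distrib)
  have "frac_diff \<alpha> \<theta> t (\<lambda>k. (v k)\<^sup>2) n - 2 * (w * frac_diff \<alpha> \<theta> t v n)
      = (\<Sum>k=1..n. A n k * (d k - d (k - 1)))"
    unfolding frac_diff_def d_def sum_distrib_left sum_subtractf[symmetric]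
    by (intro sum.cong refl) (simp add: power2_eq_square algebra_simps)
  also have "\<dots> \<le> 0"
  proof (cases "n = 1")
    case True
    have "\<theta>\<^sup>2 \<le> (1 - \<theta>)\<^sup>2" using alpha theta by (intro power_mono) auto
    then have "\<theta>\<^sup>2 * \<delta>\<^sup>2 \<le> (1 - \<theta>)\<^sup>2 * \<delta>\<^sup>2" by (intro mult_right_mono) auto
    then show ?thesis using True d kernel_A_pos[of 1 1] assms by (simp add: mult_nonneg_nonpos)
  next
    case False
    then obtain m where n: "n = Suc m" "1 \<le> m" using assms by (cases n) auto
    have "(\<Sum>k=1..n. A n k * (d k - d (k - 1)))
        = (\<Sum>k=1..m. A n k * (d k - d (k - 1))) + A n n * (d n - d m)"
      using n by simp
    also have "\<dots> \<le> A n m * d m + A n n * (d n - d m)"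
    proof (intro add_right_mono sum_increasing_weights_le)
      show "0 \<le> A n k" if "1 \<le> k" "k \<le> m" for k
        using kernel_A_pos[of k n] that n assms by simp
      show "A n k \<le> A n (k + 1)" if "1 \<le> k" "k < m" for k
        using kernel_A_mono[of k n] that n assms by simp
    qed (use n in \<open>auto simp: d_def\<close>)
    also have "d n = \<theta>\<^sup>2 * \<delta>\<^sup>2" by (rule d)
    also have "d m = (1 - \<theta>)\<^sup>2 * \<delta>\<^sup>2" using d n by simp
    also have "A n m * ((1 - \<theta>)\<^sup>2 * \<delta>\<^sup>2) + A n n * (\<theta>\<^sup>2 * \<delta>\<^sup>2 - (1 - \<theta>)\<^sup>2 * \<delta>\<^sup>2)
        = ((1 - \<theta>) * ((1 - \<theta>) * A n m) - (1 - \<alpha>) * A n n) * \<delta>\<^sup>2"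
      unfolding theta_bounds(3) by (simp add: power2_eq_square algebra_simps)
    also have "\<dots> \<le> 0"
    proof (rule mult_nonpos_nonneg)
      have "(1 - \<theta>) * ((1 - \<theta>) * A n m) \<le> 1 * ((1 - \<theta>) * A n m)"
        using kernel_A_pos[of m n] n assms alpha theta by (intro mult_right_mono) auto
      also have "\<dots> \<le> (1 - \<alpha>) * A n n" using kernel_A_last_two[of n] n assms by simp
      finally show "(1 - \<theta>) * ((1 - \<theta>) * A n m) - (1 - \<alpha>) * A n n \<le> 0" by simp
    qed simp
    finally show ?thesis .
  qed
  finally show ?thesis by (simp add: w_def)
qed


section \<open>Complementary kernels\<close>

lemma kernel_P_nonneg:
  assumes "1 \<le> j" "j \<le> n" "n \<le> N"
  shows "0 \<le> P n j"
proof -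
  have "1 \<le> j \<Longrightarrow> 0 \<le> P n j" if "n - j = d" for d j
    using that
  proof (induction d arbitrary: j rule: less_induct)
    case (less d)
    show ?case
    proof (cases "n \<le> j")
      case True
      then have "P n j = 1 / A n n" by (subst kernel_P.simps) simp
      then show ?thesis using kernel_A_pos[of n n] assms by simp
    next
      case False
      have "0 \<le> (A k (j + 1) - A k j) * P n k" if "k \<in> {j+1..n}" for k
        using that kernel_A_mono[of j k] less.prems less.IH[of "n - k" k] False assms(3)
        by (intro mult_nonneg_nonneg) auto
      moreover have "P n j = 1 / A j j * (\<Sum>k=j+1..n. (A k (j + 1) - A k j) * P n k)"
        using False by (subst kernel_P.simps) simp
      ultimately show ?thesis
        using kernel_A_pos[of j j] less.prems False assms(3) by (auto intro!: divide_nonneg_pos sum_nonneg)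
    qed
  qed
  then show ?thesis using assms by blast
qed

lemma kernel_P_sum:
  assumes "1 \<le> k" "k \<le> n" "n \<le> N"
  shows "(\<Sum>j=k..n. P n j * A j k) = 1"
proof (rule kernel_P_complementary)
  show "A j j \<noteq> 0" if "k \<le> j" "j \<le> n" for j
    using kernel_A_pos[of j j] that assms by simp
qed (use assms in simp)

text \<open>The discrete counterpart of applying the fractional integral to the Caputo derivative: exchange the
  sums, use complementarity, telescope.\<close>
lemma kernel_P_inverts_frac_diff:
  assumes "n \<le> N"
  shows "(\<Sum>j=1..n. P n j * frac_diff \<alpha> \<theta> t v j) = v n - v 0"
proof -
  have "(\<Sum>j=1..n. P n j * frac_diff \<alpha> \<theta> t v j)
      = (\<Sum>k=1..n. (\<Sum>j=k..n. P n j * A j k) * (v k - v (k - 1)))"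
    unfolding frac_diff_def sum_distrib_left sum_triangle_swap sum_distrib_right
    by (simp add: mult.assoc)
  also have "\<dots> = (\<Sum>k=1..n. v k - v (k - 1))"
    using assms by (intro sum.cong) (auto simp: kernel_P_sum)
  also have "\<dots> = v n - v 0"
    using sum_telescope''[of 0 n v] by simp
  finally show ?thesis .
qed

text \<open>The outer sum stops at \<open>n - 1\<close>, so complementarity leaves an inequality instead of an identity; in
  return \<open>D\<close> is evaluated only before the last step.\<close>
lemma kernel_P_sum_history_le:
  assumes "1 \<le> n" "n \<le> N" "\<And>k. 1 \<le> k \<Longrightarrow> k < n \<Longrightarrow> 0 \<le> D k"
  shows "(\<Sum>j=1..n-1. P n j * (\<Sum>k=1..j. A j k * D k)) \<le> (\<Sum>k=1..n-1. D k)"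
proof -
  have "(\<Sum>j=1..n-1. P n j * (\<Sum>k=1..j. A j k * D k))
      = (\<Sum>k=1..n-1. (\<Sum>j=k..n-1. P n j * A j k) * D k)"
    unfolding sum_distrib_left sum_triangle_swap sum_distrib_right by (simp add: mult.assoc)
  also have "\<dots> \<le> (\<Sum>k=1..n-1. 1 * D k)"
  proof (intro sum_mono mult_right_mono)
    fix k assume k: "k \<in> {1..n-1}"
    have "(\<Sum>j=k..n-1. P n j * A j k) \<le> (\<Sum>j=k..n. P n j * A j k)"
      using k assms
      by (intro sum_mono2 mult_nonneg_nonneg kernel_P_nonneg less_imp_le[OF kernel_A_pos]) auto
    also have "\<dots> = 1" using kernel_P_sum[of k n] k assms by auto
    finally show "(\<Sum>j=k..n-1. P n j * A j k) \<le> 1" .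
    show "0 \<le> D k" using k assms by auto
  qed
  finally show ?thesis by simp
qed

lemma kernel_P_last_le:
  assumes "1 \<le> n" "n \<le> N"
  shows "P n n \<le> 11 / 4 * Gamma (2 - \<alpha>) * \<tau> n powr \<alpha>"
proof -
  have tn: "0 < \<tau> n" using tau_pos assms by simp
  have G: "0 < Gamma (2 - \<alpha>)" using alpha by simp
  have "integral {t (n - 1)..t n} (\<lambda>s. omega (1 - \<alpha>) (t n - s))
      = omega (1 - \<alpha> + 1) (t n - t (n - 1)) - omega (1 - \<alpha> + 1) (t n - t n)"
    using grid[of n] assms alpha
    by (intro integral_unique has_integral_omega_reflected) auto
  also have "\<dots> = \<tau> n * (\<tau> n powr - \<alpha>) / Gamma (2 - \<alpha>)"
    using tn by (simp add: omega_def t_diff powr_diff powr_minus divide_inverse)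
  finally have "\<tau> n * (4 / 11 * (\<tau> n powr - \<alpha> / Gamma (2 - \<alpha>))) \<le> \<tau> n * A n n"
    using kernel_A_ge[of n n] assms by simp
  then have "4 / 11 * (\<tau> n powr - \<alpha> / Gamma (2 - \<alpha>)) \<le> A n n"
    using tn by (rule mult_left_le_imp_le)
  then have "1 / A n n \<le> 1 / (4 / 11 * (\<tau> n powr - \<alpha> / Gamma (2 - \<alpha>)))"
    using tn G kernel_A_pos[of n n] assms by (intro divide_left_mono mult_pos_pos) auto
  also have "\<dots> = 11 / 4 * Gamma (2 - \<alpha>) * \<tau> n powr \<alpha>"
    by (simp add: powr_minus_divide)
  finally show ?thesis by (subst kernel_P.simps) simp
qed

text \<open>The first kernel of level \<open>j\<close> alone dominates \<open>omega (1 - \<alpha>) (t j)\<close>, since the weight increases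
  over the first step.\<close>
lemma omega_le_kernel_A_first:
  assumes "1 \<le> j" "j \<le> N"
  shows "omega (1 - \<alpha>) (t j) \<le> 11 / 4 * A j 1"
proof -
  have t1: "0 < t 1" "t 1 \<le> t j" using t_pos[of 1] t_mono[of 1 j] assms by auto
  have "\<tau> 1 * omega (1 - \<alpha>) (t j) \<le> integral {0..t 1} (\<lambda>s. omega (1 - \<alpha>) (t j - s))"
    \<comment> \<open>The open interval avoids \<open>s = t j\<close> when \<open>j = 1\<close>, where \<open>omega\<close> has the value \<open>0\<close>.\<close>
  proof (rule has_integral_le)
    show "((\<lambda>s. omega (1 - \<alpha>) (t j)) has_integral \<tau> 1 * omega (1 - \<alpha>) (t j)) {0<..<t 1}"
      using has_integral_const_real[of "omega (1 - \<alpha>) (t j)" 0 "t 1"] t1 t_0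
      by (simp add: time_step_def flip: has_integral_Icc_iff_Ioo)
    show "((\<lambda>s. omega (1 - \<alpha>) (t j - s)) has_integral
        integral {0..t 1} (\<lambda>s. omega (1 - \<alpha>) (t j - s))) {0<..<t 1}"
      unfolding has_integral_Icc_iff_Ioo[symmetric]
      using t1 alpha by (intro integrable_integral has_integral_integrable[OF has_integral_omega_reflected]) auto
    show "omega (1 - \<alpha>) (t j) \<le> omega (1 - \<alpha>) (t j - s)" if "s \<in> {0<..<t 1}" for s
      using that t1 alpha by (intro omega_antimono) auto
  qed
  also have "\<dots> \<le> \<tau> 1 * (11 / 4 * A j 1)"
    using kernel_A_ge[of 1 j] assms t_0 by simp
  finally show ?thesis using tau_pos[of 1] assms by simp
qed

lemma kernel_P_sum_omega_le:
  assumes "1 \<le> n" "n \<le> N"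
  shows "(\<Sum>j=1..n. P n j * omega (1 - \<alpha>) (t j)) \<le> 11 / 4"
proof -
  have "(\<Sum>j=1..n. P n j * omega (1 - \<alpha>) (t j)) \<le> (\<Sum>j=1..n. P n j * (11 / 4 * A j 1))"
    using assms by (intro sum_mono mult_left_mono omega_le_kernel_A_first kernel_P_nonneg) auto
  also have "\<dots> = 11 / 4 * (\<Sum>j=1..n. P n j * A j 1)"
    by (simp add: sum_distrib_left mult_ac)
  finally show ?thesis using kernel_P_sum[of 1 n] assms by simp
qed

lemma kernel_P_sum_le:
  assumes "1 \<le> n" "n \<le> N" "\<And>j. 1 \<le> j \<Longrightarrow> j \<le> n \<Longrightarrow> t j powr \<alpha> * g j \<le> B" "0 \<le> B"
  shows "(\<Sum>j=1..n. P n j * g j) \<le> 11 / 4 * Gamma (1 - \<alpha>) * B"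
proof -
  have G: "0 < Gamma (1 - \<alpha>)" using alpha by simp
  have "(\<Sum>j=1..n. P n j * g j) \<le> (\<Sum>j=1..n. P n j * (Gamma (1 - \<alpha>) * B * omega (1 - \<alpha>) (t j)))"
  proof (intro sum_mono mult_left_mono)
    fix j assume j: "j \<in> {1..n}"
    have tj: "0 < t j" using t_pos[of j] j assms by auto
    have "g j = t j powr \<alpha> * g j * t j powr - \<alpha>" using tj by (simp add: powr_minus)
    also have "\<dots> \<le> B * t j powr - \<alpha>" using assms(3)[of j] j by (intro mult_right_mono) auto
    also have "\<dots> = Gamma (1 - \<alpha>) * B * omega (1 - \<alpha>) (t j)" using G by (simp add: omega_def)
    finally show "g j \<le> Gamma (1 - \<alpha>) * B * omega (1 - \<alpha>) (t j)" .
    show "0 \<le> P n j" using j assms by (intro kernel_P_nonneg) auto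
  qed
  also have "\<dots> = Gamma (1 - \<alpha>) * B * (\<Sum>j=1..n. P n j * omega (1 - \<alpha>) (t j))"
    by (simp add: sum_distrib_left mult_ac)
  also have "\<dots> \<le> Gamma (1 - \<alpha>) * B * (11 / 4)"
    using kernel_P_sum_omega_le[of n] assms G by (intro mult_left_mono) auto
  finally show ?thesis by simp
qed

lemma convolution_integrable:
  assumes "0 < \<beta>" "1 \<le> k" "k \<le> j" "j \<le> N"
  shows "(\<lambda>s. omega (1 - \<alpha>) (t j - s) * omega \<beta> s) integrable_on {t (k - 1)..t k}"
proof (rule integrable_on_subinterval)
  show "(\<lambda>s. omega (1 - \<alpha>) (t j - s) * omega \<beta> s) integrable_on {0..t j}"
    using omega_convolution[of "1 - \<alpha>" \<beta> "t j"] t_pos[of j] assms alpha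
    by (auto simp: integrable_on_def)
  show "{t (k - 1)..t k} \<subseteq> {0..t j}"
    using t_nonneg[of "k - 1"] t_mono[of k j] assms by auto
qed

text \<open>For \<open>\<beta> \<le> 1\<close> the two factors are oppositely monotone, so the integral of the product is at most the
  product of means, and the mean of the first factor is controlled by the kernel.\<close>
lemma convolution_piece_concave:
  assumes "0 < \<beta>" "\<beta> \<le> 1" "1 \<le> k" "k \<le> j" "j \<le> N"
  shows "integral {t (k - 1)..t k} (\<lambda>s. omega (1 - \<alpha>) (t j - s) * omega \<beta> s)
    \<le> 11 / 4 * (A j k * (omega (\<beta> + 1) (t k) - omega (\<beta> + 1) (t (k - 1))))"
proof -
  let ?I = "{t (k - 1)..t k}"
  have tk: "0 < \<tau> k" "0 \<le> t (k - 1)" "t (k - 1) \<le> t k" "t k \<le> t j"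
    using tau_pos[of k] t_nonneg[of "k - 1"] grid[of k] t_mono[of k j] assms by auto
  have \<beta>: "(omega \<beta> has_integral omega (\<beta> + 1) (t k) - omega (\<beta> + 1) (t (k - 1))) ?I"
    using tk assms by (intro has_integral_omega) auto
  have D: "0 \<le> omega (\<beta> + 1) (t k) - omega (\<beta> + 1) (t (k - 1))"
    using omega_mono[of "\<beta> + 1" "t (k - 1)" "t k"] tk assms by simp
  have "(t k - t (k - 1)) * integral ?I (\<lambda>s. omega (1 - \<alpha>) (t j - s) * omega \<beta> s)
      \<le> integral ?I (\<lambda>s. omega (1 - \<alpha>) (t j - s)) * integral ?I (omega \<beta>)"
  proof (rule chebyshev_integral_inequality)
    show "(\<lambda>s. omega (1 - \<alpha>) (t j - s)) integrable_on ?I"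
      using tk alpha by (intro has_integral_integrable[OF has_integral_omega_reflected]) auto
    show "(\<lambda>s. omega (1 - \<alpha>) (t j - s) * omega \<beta> s) integrable_on ?I"
      using assms by (intro convolution_integrable) auto
  qed (use tk assms \<beta> alpha in \<open>auto intro!: omega_antimono\<close>)
  also have "\<dots> \<le> (\<tau> k * (11 / 4 * A j k)) * integral ?I (omega \<beta>)"
    using kernel_A_ge[of k j] assms D \<beta> by (intro mult_right_mono) (auto simp: integral_unique)
  finally have "\<tau> k * integral ?I (\<lambda>s. omega (1 - \<alpha>) (t j - s) * omega \<beta> s)
      \<le> \<tau> k * (11 / 4 * (A j k * (omega (\<beta> + 1) (t k) - omega (\<beta> + 1) (t (k - 1)))))"
    unfolding integral_unique[OF \<beta>] by (simp add: t_diff mult.assoc)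
  then show ?thesis using tk(1) by (rule mult_left_le_imp_le)
qed

text \<open>For \<open>\<beta> \<ge> 1\<close> both factors increase and the comparison of means fails; the value at the right end
  point replaces the second factor.\<close>
lemma convolution_piece_convex:
  assumes "1 \<le> \<beta>" "1 \<le> k" "k \<le> j" "j \<le> N"
  shows "integral {t (k - 1)..t k} (\<lambda>s. omega (1 - \<alpha>) (t j - s) * omega \<beta> s)
    \<le> 11 / 4 * (A j k * (\<tau> k * omega \<beta> (t k)))"
proof -
  let ?I = "{t (k - 1)..t k}"
  have tk: "0 \<le> t (k - 1)" "t (k - 1) \<le> t k" "t k \<le> t j"
    using t_nonneg[of "k - 1"] grid[of k] t_mono[of k j] assms by auto
  have w: "(\<lambda>s. omega (1 - \<alpha>) (t j - s)) integrable_on ?I"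
    using tk alpha by (intro has_integral_integrable[OF has_integral_omega_reflected]) auto
  have "integral ?I (\<lambda>s. omega (1 - \<alpha>) (t j - s) * omega \<beta> s)
      \<le> integral ?I (\<lambda>s. omega (1 - \<alpha>) (t j - s) * omega \<beta> (t k))"
  proof (rule integral_le)
    show "(\<lambda>s. omega (1 - \<alpha>) (t j - s) * omega \<beta> s) integrable_on ?I"
      using assms by (intro convolution_integrable) auto
    show "(\<lambda>s. omega (1 - \<alpha>) (t j - s) * omega \<beta> (t k)) integrable_on ?I"
      using w by (intro integrable_on_mult_left)
    show "omega (1 - \<alpha>) (t j - s) * omega \<beta> s \<le> omega (1 - \<alpha>) (t j - s) * omega \<beta> (t k)"
      if "s \<in> ?I" for s
      using that tk alpha assms by (intro mult_left_mono omega_mono omega_nonneg) auto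
  qed
  also have "\<dots> = integral ?I (\<lambda>s. omega (1 - \<alpha>) (t j - s)) * omega \<beta> (t k)" by simp
  also have "\<dots> \<le> (\<tau> k * (11 / 4 * A j k)) * omega \<beta> (t k)"
    using kernel_A_ge[of k j] assms by (intro mult_right_mono omega_nonneg) auto
  finally show ?thesis by (simp add: mult_ac)
qed

lemma convolution_split:
  assumes "0 < \<beta>" "1 \<le> j" "j \<le> N"
  shows "omega (1 - \<alpha> + \<beta>) (t j)
    = (\<Sum>k=1..j. integral {t (k - 1)..t k} (\<lambda>s. omega (1 - \<alpha>) (t j - s) * omega \<beta> s))"
proof -
  let ?f = "\<lambda>s. omega (1 - \<alpha>) (t j - s) * omega \<beta> s"
  have f: "(?f has_integral omega (1 - \<alpha> + \<beta>) (t j)) {0..t j}"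
    using omega_convolution[of "1 - \<alpha>" \<beta> "t j"] t_pos[of j] assms alpha by simp
  have "integral {0..t m} ?f = (\<Sum>k=1..m. integral {t (k - 1)..t k} ?f)" if "m \<le> j" for m
    using that
  proof (induction m)
    case 0
    then show ?case by (simp add: t_0)
  next
    case (Suc m)
    have "?f integrable_on {0..t (Suc m)}"
      using f t_mono[of "Suc m" j] Suc.prems assms
      by (intro integrable_on_subinterval[OF has_integral_integrable[OF f]]) auto
    then have "integral {0..t (Suc m)} ?f = integral {0..t m} ?f + integral {t m..t (Suc m)} ?f"
      using t_nonneg[of m] grid[of "Suc m"] Suc.prems assms
      by (intro Henstock_Kurzweil_Integration.integral_combine[symmetric]) auto
    then show ?case using Suc by simp
  qed
  from this[of j] f show ?thesis by (simp add: integral_unique)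
qed

text \<open>The quantity \<open>D k\<close> is the factor that multiplies the kernel in the bound for one step.  In the convex
  case it overshoots the increment of \<open>\<omega>\<^bsub>1+\<beta>\<^esub>\<close> over step \<open>k\<close>, but it is at most \<open>7/4\<close> times the increment
  over step \<open>k + 1\<close>.  This shift by one step is affordable because the sum ends at \<open>n - 1\<close>.\<close>
lemma kernel_P_sum_fractional_le:
  assumes "0 < \<beta>" "1 \<le> n" "n \<le> N"
  shows "(\<Sum>j=1..n-1. P n j * omega (1 - \<alpha> + \<beta>) (t j)) \<le> 77 / 16 * omega (\<beta> + 1) (t n)"
proof -
  define D where "D k = (if \<beta> \<le> 1 then omega (\<beta> + 1) (t k) - omega (\<beta> + 1) (t (k - 1))
    else \<tau> k * omega \<beta> (t k))" for k
  have D_nonneg: "0 \<le> D k" if "1 \<le> k" "k < n" for k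
    using omega_mono[of "\<beta> + 1" "t (k - 1)" "t k"] omega_nonneg[of \<beta> "t k"] tau_pos[of k]
      t_nonneg[of "k - 1"] grid[of k] that assms
    unfolding D_def by (auto intro!: mult_nonneg_nonneg)
  have W0: "omega (\<beta> + 1) (t 0) = 0" by (simp add: omega_def t_0)
  have D_sum: "(\<Sum>k=1..n-1. D k) \<le> 7 / 4 * omega (\<beta> + 1) (t n)"
  proof (cases "\<beta> \<le> 1")
    case True
    have "(\<Sum>k=1..n-1. D k) = omega (\<beta> + 1) (t (n - 1))"
      using sum_telescope''[of 0 "n - 1" "\<lambda>k. omega (\<beta> + 1) (t k)"] True W0 by (simp add: D_def)
    also have "\<dots> \<le> omega (\<beta> + 1) (t n)"
      using t_nonneg[of "n - 1"] t_mono[of "n - 1" n] assms by (intro omega_mono) auto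
    finally show ?thesis using omega_nonneg[of "\<beta> + 1" "t n"] assms by simp
  next
    case False
    have "D k \<le> 7 / 4 * (omega (\<beta> + 1) (t (Suc k)) - omega (\<beta> + 1) (t k))" if "k \<in> {1..n-1}" for k
    proof -
      have k: "1 \<le> k" "k < N" "k \<le> N" using that assms by auto
      have "\<tau> (Suc k) * omega \<beta> (t k) \<le> omega (\<beta> + 1) (t (Suc k)) - omega (\<beta> + 1) (t k)"
      proof (rule has_integral_le)
        show "((\<lambda>s. omega \<beta> (t k)) has_integral \<tau> (Suc k) * omega \<beta> (t k)) {t k..t (Suc k)}"
          using has_integral_const_real[of "omega \<beta> (t k)" "t k" "t (Suc k)"] grid[of "Suc k"] k
          by (simp add: time_step_def)
        show "(omega \<beta> has_integral omega (\<beta> + 1) (t (Suc k)) - omega (\<beta> + 1) (t k)) {t k..t (Suc k)}"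
          using grid[of "Suc k"] t_nonneg[of k] k assms by (intro has_integral_omega) auto
        show "omega \<beta> (t k) \<le> omega \<beta> s" if "s \<in> {t k..t (Suc k)}" for s
          using that False t_nonneg[of k] k by (intro omega_mono) auto
      qed
      moreover have "\<tau> k * omega \<beta> (t k) \<le> 7 / 4 * \<tau> (Suc k) * omega \<beta> (t k)"
        using tau_le[of k] k assms by (intro mult_right_mono omega_nonneg) auto
      ultimately show ?thesis using False by (simp add: D_def)
    qed
    then have "(\<Sum>k=1..n-1. D k)
        \<le> (\<Sum>k=1..n-1. 7 / 4 * (omega (\<beta> + 1) (t (Suc k)) - omega (\<beta> + 1) (t k)))"
      by (rule sum_mono)
    also have "\<dots> = 7 / 4 * (omega (\<beta> + 1) (t n) - omega (\<beta> + 1) (t 1))"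
      unfolding sum_distrib_left[symmetric]
      using sum_Suc_diff[of 1 "n - 1" "\<lambda>k. omega (\<beta> + 1) (t k)"] assms by simp
    finally show ?thesis using omega_nonneg[of "\<beta> + 1" "t 1"] assms by simp
  qed
  have "(\<Sum>j=1..n-1. P n j * omega (1 - \<alpha> + \<beta>) (t j))
      \<le> (\<Sum>j=1..n-1. P n j * (11 / 4 * (\<Sum>k=1..j. A j k * D k)))"
  proof (intro sum_mono mult_left_mono)
    fix j assume j: "j \<in> {1..n-1}"
    then have "omega (1 - \<alpha> + \<beta>) (t j)
        = (\<Sum>k=1..j. integral {t (k - 1)..t k} (\<lambda>s. omega (1 - \<alpha>) (t j - s) * omega \<beta> s))"
      using assms by (intro convolution_split) auto
    also have "\<dots> \<le> (\<Sum>k=1..j. 11 / 4 * (A j k * D k))"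
      using j assms convolution_piece_concave[of \<beta> _ j] convolution_piece_convex[of \<beta> _ j]
      by (intro sum_mono) (auto simp: D_def)
    finally show "omega (1 - \<alpha> + \<beta>) (t j) \<le> 11 / 4 * (\<Sum>k=1..j. A j k * D k)"
      by (simp add: sum_distrib_left)
    show "0 \<le> P n j" using j assms by (intro kernel_P_nonneg) auto
  qed
  also have "\<dots> = 11 / 4 * (\<Sum>j=1..n-1. P n j * (\<Sum>k=1..j. A j k * D k))"
    unfolding sum_distrib_left by (simp add: mult_ac)
  also have "\<dots> \<le> 11 / 4 * (\<Sum>k=1..n-1. D k)"
    using kernel_P_sum_history_le[of n D] D_nonneg assms by (intro mult_left_mono) auto
  also have "\<dots> \<le> 11 / 4 * (7 / 4 * omega (\<beta> + 1) (t n))"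
    using D_sum by (intro mult_left_mono) auto
  finally show ?thesis by simp
qed

end


section \<open>The Mittag-Leffler function\<close>

text \<open>By log-convexity the slope of \<open>ln \<circ> Gamma\<close> on \<open>[x, x + \<alpha>]\<close> is at least its slope on \<open>[x - 1, x]\<close>,
  which is \<open>ln (x - 1)\<close> by the functional equation.\<close>
lemma Gamma_add_ge:
  fixes x \<alpha> :: real
  assumes "1 < x" "0 < \<alpha>"
  shows "(x - 1) powr \<alpha> * Gamma x \<le> Gamma (x + \<alpha>)"
proof -
  define l where "l = (ln \<circ> Gamma :: real \<Rightarrow> real)"
  have "\<alpha> / (1 + \<alpha>) * (x - 1) + 1 / (1 + \<alpha>) * (x + \<alpha>) = (\<alpha> * (x - 1) + (x + \<alpha>)) / (1 + \<alpha>)"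
    by (simp add: add_divide_distrib)
  also have "\<alpha> * (x - 1) + (x + \<alpha>) = x * (1 + \<alpha>)" by (simp add: algebra_simps)
  finally have "\<alpha> / (1 + \<alpha>) * (x - 1) + 1 / (1 + \<alpha>) * (x + \<alpha>) = x"
    using assms by simp
  moreover have "l (\<alpha> / (1 + \<alpha>) * (x - 1) + 1 / (1 + \<alpha>) * (x + \<alpha>))
      \<le> \<alpha> / (1 + \<alpha>) * l (x - 1) + 1 / (1 + \<alpha>) * l (x + \<alpha>)"
    using convex_onD[OF log_convex_Gamma_real, of "1 / (1 + \<alpha>)" "x - 1" "x + \<alpha>"] assms
    by (simp add: l_def field_simps)
  moreover have "\<alpha> / (1 + \<alpha>) * l (x - 1) + 1 / (1 + \<alpha>) * l (x + \<alpha>)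
      = (\<alpha> * l (x - 1) + l (x + \<alpha>)) / (1 + \<alpha>)"
    by (simp add: add_divide_distrib)
  ultimately have "l x \<le> (\<alpha> * l (x - 1) + l (x + \<alpha>)) / (1 + \<alpha>)" by simp
  then have "(1 + \<alpha>) * l x \<le> \<alpha> * l (x - 1) + l (x + \<alpha>)"
    using assms by (simp add: pos_le_divide_eq mult.commute)
  moreover have "l x = ln (x - 1) + l (x - 1)"
  proof -
    have "Gamma x = (x - 1) * Gamma (x - 1)"
      using Gamma_plus1[of "x - 1"] nonpos_Ints_nonpos[of "x - 1"] assms by auto
    moreover have "Gamma (x - 1) \<noteq> 0" using assms Gamma_real_pos[of "x - 1"] by linarith
    ultimately show ?thesis using assms by (simp add: l_def ln_mult)
  qed
  ultimately have "\<alpha> * ln (x - 1) + l x \<le> l (x + \<alpha>)" by (simp add: algebra_simps)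
  then have "exp (\<alpha> * ln (x - 1) + l x) \<le> exp (l (x + \<alpha>))" by simp
  then show ?thesis using assms by (simp add: exp_add powr_def l_def)
qed

text \<open>By \<open>Gamma_add_ge\<close> the quotient of successive terms is at most \<open>z / (k\<alpha>)\<^bsup>\<alpha>\<^esup>\<close>, which tends to \<open>0\<close>.\<close>
lemma mittag_leffler_summable:
  fixes z \<alpha> :: real
  assumes "0 < \<alpha>" "0 \<le> z"
  shows "summable (\<lambda>k. z ^ k / Gamma (1 + real k * \<alpha>))"
proof -
  obtain M :: nat where "(2 * z) powr (1 / \<alpha>) / \<alpha> \<le> real M"
    using real_arch_simple by blast
  then have M: "2 * z \<le> (real k * \<alpha>) powr \<alpha>" if "M \<le> k" for k
  proof -
    have "(2 * z) powr (1 / \<alpha>) \<le> real M * \<alpha>"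
      using \<open>_ \<le> real M\<close> assms(1) by (simp add: divide_le_eq)
    also have "\<dots> \<le> real k * \<alpha>" using that assms(1) by simp
    finally have "((2 * z) powr (1 / \<alpha>)) powr \<alpha> \<le> (real k * \<alpha>) powr \<alpha>"
      using assms by (intro powr_mono2) auto
    then show ?thesis using assms by (simp add: powr_powr)
  qed
  show ?thesis
  proof (rule summable_ratio_test)
    show "1 / 2 < (1::real)" by simp
    fix k assume "max M 1 \<le> k"
    then have k: "M \<le> k" "0 < real k * \<alpha>" using assms by auto
    have G: "0 < Gamma (1 + real k * \<alpha>)" "0 < Gamma (1 + real (Suc k) * \<alpha>)"
      using k assms by (auto intro!: Gamma_real_pos add_pos_nonneg)
    have "2 * z * Gamma (1 + real k * \<alpha>) \<le> (real k * \<alpha>) powr \<alpha> * Gamma (1 + real k * \<alpha>)"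
      using M[OF k(1)] G by (intro mult_right_mono) auto
    also have "\<dots> \<le> Gamma (1 + real (Suc k) * \<alpha>)"
      using Gamma_add_ge[of "1 + real k * \<alpha>" \<alpha>] k assms by (simp add: algebra_simps)
    finally have "z ^ k * (2 * z * Gamma (1 + real k * \<alpha>)) \<le> z ^ k * Gamma (1 + real (Suc k) * \<alpha>)"
      using assms by (intro mult_left_mono) auto
    then show "norm (z ^ Suc k / Gamma (1 + real (Suc k) * \<alpha>))
        \<le> 1 / 2 * norm (z ^ k / Gamma (1 + real k * \<alpha>))"
      using G assms by (simp add: field_simps)
  qed
qed

lemma mittag_leffler_mono:
  assumes "0 < \<alpha>" "0 \<le> y" "y \<le> z"
  shows "mittag_leffler \<alpha> y \<le> mittag_leffler \<alpha> z"
  unfolding mittag_leffler_def using assms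
  by (intro suminf_le mittag_leffler_summable divide_right_mono power_mono
        less_imp_le[OF Gamma_real_pos] add_pos_nonneg) auto

lemma mittag_leffler_ge_1:
  assumes "0 < \<alpha>" "0 \<le> z"
  shows "1 \<le> mittag_leffler \<alpha> z"
proof -
  have "mittag_leffler \<alpha> 0 = 1"
    unfolding mittag_leffler_def by (subst suminf_finite[of "{0}"]) auto
  then show ?thesis using mittag_leffler_mono[of \<alpha> 0 z] assms by simp
qed

lemma mittag_leffler_sums_omega:
  assumes "0 < \<alpha>" "0 \<le> \<mu>" "0 < x"
  shows "(\<lambda>m. \<mu> ^ m * omega (real m * \<alpha> + 1) x) sums mittag_leffler \<alpha> (\<mu> * x powr \<alpha>)"
proof -
  have "(\<mu> * x powr \<alpha>) ^ m / Gamma (1 + real m * \<alpha>) = \<mu> ^ m * omega (real m * \<alpha> + 1) x" for m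
  proof -
    have "(x powr \<alpha>) ^ m = x powr (real m * \<alpha>)"
      using assms by (simp add: powr_powr mult.commute flip: powr_realpow)
    then show ?thesis by (simp add: omega_def power_mult_distrib add.commute)
  qed
  then show ?thesis
    using summable_sums[OF mittag_leffler_summable[of \<alpha> "\<mu> * x powr \<alpha>"]] assms
    by (simp add: mittag_leffler_def)
qed

text \<open>Discrete form of the fact that \<open>F = E\<^sub>\<alpha>(\<mu> t\<^bsup>\<alpha>\<^esup>)\<close> has Caputo derivative \<open>\<mu> F\<close>, so that \<open>\<mu>\<close> times its
  fractional integral is \<open>F - 1\<close>.  Integration raises each power in the series to the next one, hence
  the shift of the summation index.\<close>
lemma (in alikhanov_grid) kernel_P_sum_mittag_leffler_le:
  assumes "0 \<le> \<mu>" "1 \<le> n" "n \<le> N"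
  shows "\<mu> * (\<Sum>j=1..n-1. P n j * mittag_leffler \<alpha> (\<mu> * t j powr \<alpha>))
    \<le> 77 / 16 * (mittag_leffler \<alpha> (\<mu> * t n powr \<alpha>) - 1)"
proof (rule sums_le)
  show "(\<lambda>m. \<mu> * (\<Sum>j=1..n-1. P n j * (\<mu> ^ m * omega (real m * \<alpha> + 1) (t j)))) sums
      (\<mu> * (\<Sum>j=1..n-1. P n j * mittag_leffler \<alpha> (\<mu> * t j powr \<alpha>)))"
    using assms alpha t_pos by (intro sums_mult sums_sum mittag_leffler_sums_omega) auto
  have "(\<lambda>m. \<mu> ^ Suc m * omega (real (Suc m) * \<alpha> + 1) (t n)) sums
      (mittag_leffler \<alpha> (\<mu> * t n powr \<alpha>) - 1)"
    using mittag_leffler_sums_omega[of \<alpha> \<mu> "t n"] t_pos[of n] assms alpha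
    by (subst sums_Suc_iff) (simp add: omega_def)
  then show "(\<lambda>m. 77 / 16 * (\<mu> ^ Suc m * omega (real (Suc m) * \<alpha> + 1) (t n))) sums
      (77 / 16 * (mittag_leffler \<alpha> (\<mu> * t n powr \<alpha>) - 1))"
    by (rule sums_mult)
  fix m
  have "0 < real (Suc m) * \<alpha>" using alpha by simp
  then have "(\<Sum>j=1..n-1. P n j * omega (real m * \<alpha> + 1) (t j)) \<le> 77 / 16 * omega (real (Suc m) * \<alpha> + 1) (t n)"
    using kernel_P_sum_fractional_le[of "real (Suc m) * \<alpha>" n] assms alpha by (simp add: algebra_simps)
  then have "\<mu> ^ Suc m * (\<Sum>j=1..n-1. P n j * omega (real m * \<alpha> + 1) (t j))
      \<le> \<mu> ^ Suc m * (77 / 16 * omega (real (Suc m) * \<alpha> + 1) (t n))"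
    using assms by (intro mult_left_mono) auto
  then show "\<mu> * (\<Sum>j=1..n-1. P n j * (\<mu> ^ m * omega (real m * \<alpha> + 1) (t j)))
      \<le> 77 / 16 * (\<mu> ^ Suc m * omega (real (Suc m) * \<alpha> + 1) (t n))"
    by (simp add: sum_distrib_left mult_ac)
qed


section \<open>The discrete Gronwall inequality\<close>

text \<open>In the step \<open>n\<close> at which \<open>v n\<close> is a new strict maximum, the quadratic inequality becomes linear after
  one factor is bounded by \<open>v n\<close> and divided out.  By \<open>small\<close> the term with \<open>j = n\<close> contributes at most
  \<open>v n / 2\<close>; moving it to the left doubles the rest, and the exponential rate \<open>10 \<Lambda>\<close> suffices because
  \<open>2 (77/16) \<le> 10\<close>.\<close>
lemma (in alikhanov_grid) discrete_gronwall:
  fixes v g :: "nat \<Rightarrow> real"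
  assumes \<Lambda>: "0 \<le> \<Lambda>"
    and small: "\<And>n. 1 \<le> n \<Longrightarrow> n \<le> M \<Longrightarrow> 2 * \<Lambda> * (11 / 4 * Gamma (2 - \<alpha>) * \<tau> n powr \<alpha>) \<le> 1"
    and v: "\<And>k. k \<le> M \<Longrightarrow> 0 \<le> v k"
    and g: "\<And>k. 1 \<le> k \<Longrightarrow> k \<le> M \<Longrightarrow> 0 \<le> g k"
    and ineq: "\<And>n. 1 \<le> n \<Longrightarrow> n \<le> M \<Longrightarrow>
      frac_diff \<alpha> \<theta> t (\<lambda>k. (v k)\<^sup>2) n \<le> \<Lambda> * (offset \<theta> v n)\<^sup>2 + offset \<theta> v n * g n"
    and G: "0 \<le> G" "\<And>k. 1 \<le> k \<Longrightarrow> k \<le> M \<Longrightarrow> (\<Sum>j=1..k. P k j * g j) \<le> G"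
    and M: "M \<le> N"
    and n: "n \<le> M"
  shows "v n \<le> 2 * mittag_leffler \<alpha> (10 * \<Lambda> * t n powr \<alpha>) * (v 0 + G)"
  using n
proof (induction n rule: less_induct)
  case (less n)
  define F where "F k = mittag_leffler \<alpha> (10 * \<Lambda> * t k powr \<alpha>)" for k
  define C where "C = v 0 + G"
  have C: "0 \<le> C" using v[of 0] G(1) by (simp add: C_def)
  have F1: "1 \<le> F k" for k
    unfolding F_def using alpha \<Lambda> by (intro mittag_leffler_ge_1) auto
  have F_mono: "F i \<le> F j" if "i \<le> j" "j \<le> M" for i j
    unfolding F_def using that alpha \<Lambda> M t_nonneg[of i] t_mono[of i j]
    by (intro mittag_leffler_mono mult_left_mono powr_mono2) auto
  have IH: "v k \<le> 2 * F j * C" if "k < n" "k \<le> j" "j \<le> M" for k j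
  proof -
    have "v k \<le> 2 * F k * C" using less that unfolding F_def C_def by simp
    also have "\<dots> \<le> 2 * F j * C" using F_mono that C by (intro mult_right_mono mult_left_mono) auto
    finally show ?thesis .
  qed
  show ?case
  proof (cases "n = 0 \<or> (\<exists>k<n. v n \<le> v k)")
    case True
    then have "v n \<le> 2 * F n * C"
    proof
      assume "n = 0"
      have "v 0 \<le> 1 * C" using G(1) by (simp add: C_def)
      also have "\<dots> \<le> 2 * F 0 * C" using F1[of 0] C by (intro mult_right_mono) auto
      finally show ?thesis using \<open>n = 0\<close> by simp
    next
      assume "\<exists>k<n. v n \<le> v k"
      then show ?thesis using IH[of _ n] less.prems by force
    qed
    then show ?thesis by (simp add: F_def C_def)
  next
    case False
    then have n: "1 \<le> n" "n \<le> M" "n \<le> N" and max: "\<And>k. k < n \<Longrightarrow> v k < v n"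
      using less.prems M by (auto simp: not_le)
    have vn: "0 < v n" using max[of 0] v[of 0] n by simp
    have max': "v k \<le> v n" if "k \<le> n" for k
      using max[of k] that by (cases "k = n") auto
    have off: "0 \<le> offset \<theta> v j" "offset \<theta> v j \<le> v n" if "j \<in> {1..n}" for j
    proof -
      show "0 \<le> offset \<theta> v j"
        unfolding offset_def using that v[of j] v[of "j - 1"] n theta_bounds by auto
      have "offset \<theta> v j \<le> \<theta> * v n + (1 - \<theta>) * v n"
        unfolding offset_def using that max'[of j] max'[of "j - 1"] theta_bounds
        by (intro add_mono mult_left_mono) auto
      then show "offset \<theta> v j \<le> v n" by (simp add: algebra_simps)
    qed
    have P: "0 \<le> P n j" if "j \<in> {1..n}" for j
      using that n by (intro kernel_P_nonneg) auto
    have "(v n)\<^sup>2 - (v 0)\<^sup>2 = (\<Sum>j=1..n. P n j * frac_diff \<alpha> \<theta> t (\<lambda>k. (v k)\<^sup>2) j)"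
      using kernel_P_inverts_frac_diff[of n "\<lambda>k. (v k)\<^sup>2"] n by simp
    also have "\<dots> \<le> (\<Sum>j=1..n. P n j * (v n * (\<Lambda> * offset \<theta> v j + g j)))"
    proof (intro sum_mono mult_left_mono P)
      fix j assume j: "j \<in> {1..n}"
      have "frac_diff \<alpha> \<theta> t (\<lambda>k. (v k)\<^sup>2) j \<le> offset \<theta> v j * (\<Lambda> * offset \<theta> v j + g j)"
        using ineq[of j] j n by (simp add: power2_eq_square algebra_simps)
      also have "\<dots> \<le> v n * (\<Lambda> * offset \<theta> v j + g j)"
        using off[OF j] \<Lambda> g[of j] j n by (intro mult_right_mono) auto
      finally show "frac_diff \<alpha> \<theta> t (\<lambda>k. (v k)\<^sup>2) j \<le> v n * (\<Lambda> * offset \<theta> v j + g j)" .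
    qed
    also have "\<dots> = v n * (\<Lambda> * (\<Sum>j=1..n. P n j * offset \<theta> v j) + (\<Sum>j=1..n. P n j * g j))"
      by (simp add: sum_distrib_left distrib_left sum.distrib mult_ac)
    also have "\<dots> \<le> v n * (\<Lambda> * (\<Sum>j=1..n. P n j * offset \<theta> v j) + G)"
      using G(2)[of n] n vn by (intro mult_left_mono) auto
    finally have "v n * v n \<le> v 0 * v 0 + v n * (\<Lambda> * (\<Sum>j=1..n. P n j * offset \<theta> v j) + G)"
      by (simp add: power2_eq_square)
    also have "\<dots> \<le> v n * v 0 + v n * (\<Lambda> * (\<Sum>j=1..n. P n j * offset \<theta> v j) + G)"
      using max[of 0] v[of 0] n by (intro add_right_mono mult_right_mono) auto
    finally have "v n * v n \<le> v n * (C + \<Lambda> * (\<Sum>j=1..n. P n j * offset \<theta> v j))"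
      by (simp add: C_def algebra_simps)
    then have "v n \<le> C + \<Lambda> * (\<Sum>j=1..n. P n j * offset \<theta> v j)"
      using vn by (rule mult_left_le_imp_le)
    also have "(\<Sum>j=1..n. P n j * offset \<theta> v j)
        = (\<Sum>j=1..n-1. P n j * offset \<theta> v j) + P n n * offset \<theta> v n"
      using n by (cases n) auto
    also have "C + \<Lambda> * ((\<Sum>j=1..n-1. P n j * offset \<theta> v j) + P n n * offset \<theta> v n)
        \<le> C + \<Lambda> * (\<Sum>j=1..n-1. P n j * (2 * F j * C)) + v n / 2"
    proof -
      have "(\<Sum>j=1..n-1. P n j * offset \<theta> v j) \<le> (\<Sum>j=1..n-1. P n j * (2 * F j * C))"
      proof (intro sum_mono mult_left_mono)
        fix j assume j: "j \<in> {1..n-1}"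
        have "offset \<theta> v j \<le> \<theta> * (2 * F j * C) + (1 - \<theta>) * (2 * F j * C)"
          unfolding offset_def using j n theta_bounds IH[of j j] IH[of "j - 1" j]
          by (intro add_mono mult_left_mono) auto
        then show "offset \<theta> v j \<le> 2 * F j * C" by (simp add: algebra_simps)
        show "0 \<le> P n j" using j n by (intro P) auto
      qed
      then have "\<Lambda> * (\<Sum>j=1..n-1. P n j * offset \<theta> v j) \<le> \<Lambda> * (\<Sum>j=1..n-1. P n j * (2 * F j * C))"
        using \<Lambda> by (rule mult_left_mono)
      moreover have "\<Lambda> * (P n n * offset \<theta> v n) \<le> v n / 2"
      proof -
        have "2 * \<Lambda> * P n n \<le> 2 * \<Lambda> * (11 / 4 * Gamma (2 - \<alpha>) * \<tau> n powr \<alpha>)"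
          using kernel_P_last_le[of n] n \<Lambda> by (intro mult_left_mono) auto
        also have "\<dots> \<le> 1" using small[of n] n by simp
        finally have "2 * \<Lambda> * P n n * offset \<theta> v n \<le> 1 * v n"
          by (rule mult_mono) (use off[of n] n in auto)
        then show ?thesis by simp
      qed
      ultimately show ?thesis by (simp add: algebra_simps)
    qed
    also have "(\<Sum>j=1..n-1. P n j * (2 * F j * C)) = 2 * C * (\<Sum>j=1..n-1. P n j * F j)"
      by (simp add: sum_distrib_left mult_ac)
    finally have "v n \<le> 2 * C * (1 + 2 * (\<Lambda> * (\<Sum>j=1..n-1. P n j * F j)))"
      by (simp add: algebra_simps)
    also have "\<dots> \<le> 2 * C * F n"
    proof -
      have "10 * \<Lambda> * (\<Sum>j=1..n-1. P n j * F j) \<le> 77 / 16 * (F n - 1)"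
        unfolding F_def using kernel_P_sum_mittag_leffler_le[of "10 * \<Lambda>" n] n \<Lambda> by simp
      moreover have "1 + 2 * x \<le> y" if "10 * x \<le> 77 / 16 * (y - 1)" "1 \<le> y" for x y :: real
        using that by simp
      ultimately have "1 + 2 * (\<Lambda> * (\<Sum>j=1..n-1. P n j * F j)) \<le> F n"
        using F1[of n] by (simp only: mult.assoc)
      then show ?thesis using C by (intro mult_left_mono) auto
    qed
    finally show ?thesis by (simp only: F_def C_def mult_ac)
  qed
qed


section \<open>Square-integrable functions\<close>

lemma L2_mult_integrable:
  fixes u v :: "'a::euclidean_space \<Rightarrow> real"
  assumes "u \<in> L2_space \<Omega>" "v \<in> L2_space \<Omega>"
  shows "integrable (lebesgue_on \<Omega>) (\<lambda>x. u x * v x)"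
proof (rule Bochner_Integration.integrable_bound)
  show "integrable (lebesgue_on \<Omega>) (\<lambda>x. (norm (u x))\<^sup>2 + (norm (v x))\<^sup>2)"
    using assms by (auto simp: L2_space_def)
  show "(\<lambda>x. u x * v x) \<in> borel_measurable (lebesgue_on \<Omega>)"
    using assms by (auto simp: L2_space_def)
  have "\<bar>a * b\<bar> \<le> a\<^sup>2 + b\<^sup>2" for a b :: real
    using sum_squares_bound[of a b] sum_squares_bound[of a "- b"] by (auto simp: abs_if)
  then show "AE x in lebesgue_on \<Omega>. norm (u x * v x) \<le> norm ((norm (u x))\<^sup>2 + (norm (v x))\<^sup>2)"
    by simp
qed

lemma l2_norm_nonneg: "0 \<le> l2_norm \<Omega> u"
  by (auto simp: l2_norm_def l2_inner_def intro!: Bochner_Integration.integral_nonneg)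

lemma l2_norm_square: "(l2_norm \<Omega> u)\<^sup>2 = l2_inner \<Omega> u u"
proof -
  have "0 \<le> l2_inner \<Omega> u u"
    unfolding l2_inner_def by (rule Bochner_Integration.integral_nonneg) simp
  then show ?thesis by (simp add: l2_norm_def)
qed

lemma l2_norm_square_lincomb:
  fixes u v :: "'a::euclidean_space \<Rightarrow> real"
  assumes "u \<in> L2_space \<Omega>" "v \<in> L2_space \<Omega>"
  shows "(l2_norm \<Omega> (\<lambda>x. a * u x + b * v x))\<^sup>2
    = a\<^sup>2 * (l2_norm \<Omega> u)\<^sup>2 + 2 * a * b * l2_inner \<Omega> u v + b\<^sup>2 * (l2_norm \<Omega> v)\<^sup>2"
proof -
  have eq: "(\<lambda>x. (a * u x + b * v x) * (a * u x + b * v x))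
      = (\<lambda>x. a\<^sup>2 * (u x * u x) + 2 * a * b * (u x * v x) + b\<^sup>2 * (v x * v x))"
    by (simp add: fun_eq_iff power2_eq_square algebra_simps)
  show ?thesis
    unfolding l2_norm_square l2_inner_def inner_real_def eq
    using assms by (simp add: L2_mult_integrable)
qed

text \<open>Nonnegativity of the quadratic form \<open>(a, b) \<mapsto> \<parallel>a u + b v\<parallel>\<^sup>2\<close>.\<close>
lemma l2_Cauchy_Schwarz:
  fixes u v :: "'a::euclidean_space \<Rightarrow> real"
  assumes "u \<in> L2_space \<Omega>" "v \<in> L2_space \<Omega>"
  shows "l2_inner \<Omega> u v \<le> l2_norm \<Omega> u * l2_norm \<Omega> v"
proof -
  define U V I where "U = l2_norm \<Omega> u" and "V = l2_norm \<Omega> v" and "I = l2_inner \<Omega> u v"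
  have UV: "0 \<le> U" "0 \<le> V" by (simp_all add: U_def V_def l2_norm_nonneg)
  have q: "0 \<le> a\<^sup>2 * U\<^sup>2 + 2 * a * b * I + b\<^sup>2 * V\<^sup>2" for a b
    using l2_norm_square_lincomb[OF assms, of a b] unfolding U_def V_def I_def
    by (metis zero_le_power2)
  show ?thesis
  proof (cases "0 < U * V")
    case True
    \<comment> \<open>The vectors \<open>V u\<close> and \<open>U v\<close> have equal norms.\<close>
    have "0 \<le> 2 * (U * V) * (U * V - I)"
      using q[of V "- U"] by (simp add: power2_eq_square algebra_simps)
    then show ?thesis using True by (simp add: zero_le_mult_iff U_def V_def I_def)
  next
    case False
    then have UV0: "U = 0 \<or> V = 0" using UV by (auto simp: not_less mult_le_0_iff)
    have "I \<le> 0"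
    proof (rule ccontr)
      assume "\<not> I \<le> 0"
      then have I: "0 < I" by simp
      consider "U = 0" | "V = 0" using UV0 by blast
      then show False
      proof cases
        case 1
        \<comment> \<open>For \<open>b = 1\<close> the form is affine in \<open>a\<close>; this value of \<open>a\<close> makes it \<open>- 1\<close>.\<close>
        have "2 * (- (V\<^sup>2 + 1) / (2 * I)) * 1 * I = - (V\<^sup>2 + 1)" using I by simp
        then show False using q[of "- (V\<^sup>2 + 1) / (2 * I)" 1] 1 by simp
      next
        case 2
        have "2 * 1 * (- (U\<^sup>2 + 1) / (2 * I)) * I = - (U\<^sup>2 + 1)" using I by simp
        then show False using q[of 1 "- (U\<^sup>2 + 1) / (2 * I)"] 2 by simp
      qed
    qed
    then show ?thesis using UV0 by (auto simp: U_def V_def I_def)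
  qed
qed

lemma l2_norm_offset_le:
  fixes u :: "nat \<Rightarrow> 'a::euclidean_space \<Rightarrow> real"
  assumes "u (n - 1) \<in> L2_space \<Omega>" "u n \<in> L2_space \<Omega>" "0 \<le> \<theta>" "\<theta> \<le> 1"
  shows "l2_norm \<Omega> (\<lambda>x. offset \<theta> (\<lambda>k. u k x) n) \<le> offset \<theta> (\<lambda>k. l2_norm \<Omega> (u k)) n"
proof (rule power2_le_imp_le)
  let ?U = "l2_norm \<Omega> (u (n - 1))" and ?V = "l2_norm \<Omega> (u n)"
  have "(l2_norm \<Omega> (\<lambda>x. offset \<theta> (\<lambda>k. u k x) n))\<^sup>2
      = \<theta>\<^sup>2 * ?U\<^sup>2 + 2 * \<theta> * (1 - \<theta>) * l2_inner \<Omega> (u (n - 1)) (u n) + (1 - \<theta>)\<^sup>2 * ?V\<^sup>2"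
    unfolding offset_def using assms by (intro l2_norm_square_lincomb) auto
  also have "\<dots> \<le> \<theta>\<^sup>2 * ?U\<^sup>2 + 2 * \<theta> * (1 - \<theta>) * (?U * ?V) + (1 - \<theta>)\<^sup>2 * ?V\<^sup>2"
    using assms by (intro add_mono mult_left_mono l2_Cauchy_Schwarz) auto
  also have "\<dots> = (offset \<theta> (\<lambda>k. l2_norm \<Omega> (u k)) n)\<^sup>2"
    unfolding offset_def by (simp add: power2_eq_square algebra_simps)
  finally show "(l2_norm \<Omega> (\<lambda>x. offset \<theta> (\<lambda>k. u k x) n))\<^sup>2
      \<le> (offset \<theta> (\<lambda>k. l2_norm \<Omega> (u k)) n)\<^sup>2" .
  show "0 \<le> offset \<theta> (\<lambda>k. l2_norm \<Omega> (u k)) n"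
    unfolding offset_def using assms by (simp add: l2_norm_nonneg)
qed

lemma fe_space_subset_L2_space:
  assumes "open \<Omega>" "bounded \<Omega>"
  shows "fe_space \<Omega> \<T> \<subseteq> L2_space \<Omega>"
proof
  fix u assume "u \<in> fe_space \<Omega> \<T>"
  then have cont: "continuous_on (closure \<Omega>) u" by (simp add: fe_space_def)
  have \<Omega>: "\<Omega> \<in> lmeasurable" using assms by (simp add: lmeasurable_open)
  then interpret finite_measure "lebesgue_on \<Omega>" by (rule finite_measure_lebesgue_on)
  have meas: "u \<in> borel_measurable (lebesgue_on \<Omega>)"
    using cont \<Omega> continuous_on_subset[OF cont closure_subset]
    by (intro continuous_imp_measurable_on_sets_lebesgue) auto
  have "compact (u ` closure \<Omega>)"
    using assms cont by (intro compact_continuous_image) (auto simp: compact_closure)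
  then obtain B where B: "\<And>x. x \<in> closure \<Omega> \<Longrightarrow> norm (u x) \<le> B"
    using compact_imp_bounded by (force simp: bounded_iff)
  have "integrable (lebesgue_on \<Omega>) (\<lambda>x. (norm (u x))\<^sup>2)"
  proof (rule integrable_const_bound)
    have "norm ((norm (u x))\<^sup>2) \<le> B\<^sup>2" if "x \<in> \<Omega>" for x
    proof -
      have "norm (u x) \<le> B" using B closure_subset that by blast
      then have "(norm (u x))\<^sup>2 \<le> B\<^sup>2" by (intro power_mono) auto
      then show ?thesis by simp
    qed
    then show "AE x in lebesgue_on \<Omega>. norm ((norm (u x))\<^sup>2) \<le> B\<^sup>2"
      by (intro AE_I2) auto
    show "(\<lambda>x. (norm (u x))\<^sup>2) \<in> borel_measurable (lebesgue_on \<Omega>)"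
      using meas by measurable
  qed
  then show "u \<in> L2_space \<Omega>" using meas by (simp add: L2_space_def)
qed

lemma fe_space_lincomb:
  assumes "u \<in> fe_space \<Omega> \<T>" "v \<in> fe_space \<Omega> \<T>"
  shows "(\<lambda>x. c * u x + d * v x) \<in> fe_space \<Omega> \<T>"
proof -
  have "\<exists>a b. \<forall>x\<in>K. c * u x + d * v x = a \<bullet> x + b" if K: "K \<in> \<T>" for K
  proof -
    have "\<exists>a b. \<forall>x\<in>K. u x = a \<bullet> x + b" "\<exists>a b. \<forall>x\<in>K. v x = a \<bullet> x + b"
      using assms K by (simp_all add: fe_space_def)
    then obtain a b a' b' where "\<forall>x\<in>K. u x = a \<bullet> x + b" "\<forall>x\<in>K. v x = a' \<bullet> x + b'"
      by metis
    then have "\<forall>x\<in>K. c * u x + d * v x = (c *\<^sub>R a + d *\<^sub>R a') \<bullet> x + (c * b + d * b')"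
      by (simp add: inner_add_left algebra_simps)
    then show ?thesis by blast
  qed
  then show ?thesis
    using assms unfolding fe_space_def by (auto intro!: continuous_intros)
qed

text \<open>The pointwise energy inequality, integrated over \<open>\<Omega>\<close>.\<close>
lemma (in alikhanov_grid) l2_energy_inequality:
  fixes u :: "nat \<Rightarrow> 'a::euclidean_space \<Rightarrow> real"
  assumes "1 \<le> n" "n \<le> N" "\<And>k. k \<le> n \<Longrightarrow> u k \<in> L2_space \<Omega>"
  shows "frac_diff \<alpha> \<theta> t (\<lambda>k. (l2_norm \<Omega> (u k))\<^sup>2) n
    \<le> 2 * l2_inner \<Omega> (\<lambda>x. frac_diff \<alpha> \<theta> t (\<lambda>k. u k x) n) (\<lambda>x. offset \<theta> (\<lambda>k. u k x) n)"
proof -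
  have int: "integrable (lebesgue_on \<Omega>) (\<lambda>x. u k x * u j x)" if "k \<le> n" "j \<le> n" for k j
    using assms(3) that by (intro L2_mult_integrable) auto
  have "frac_diff \<alpha> \<theta> t (\<lambda>k. (l2_norm \<Omega> (u k))\<^sup>2) n
      = (\<Sum>k=1..n. \<integral>x. A n k * ((u k x)\<^sup>2 - (u (k - 1) x)\<^sup>2) \<partial>lebesgue_on \<Omega>)"
    unfolding frac_diff_def l2_norm_square l2_inner_def inner_real_def
  proof (intro sum.cong refl)
    fix k assume "k \<in> {1..n}"
    then have "integrable (lebesgue_on \<Omega>) (\<lambda>x. u k x * u k x)"
      "integrable (lebesgue_on \<Omega>) (\<lambda>x. u (k - 1) x * u (k - 1) x)"
      by (auto intro: int)
    then show "A n k * ((\<integral>x. u k x * u k x \<partial>lebesgue_on \<Omega>)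
          - (\<integral>x. u (k - 1) x * u (k - 1) x \<partial>lebesgue_on \<Omega>))
        = (\<integral>x. A n k * ((u k x)\<^sup>2 - (u (k - 1) x)\<^sup>2) \<partial>lebesgue_on \<Omega>)"
      by (simp add: power2_eq_square)
  qed
  also have "\<dots> = (\<integral>x. frac_diff \<alpha> \<theta> t (\<lambda>k. (u k x)\<^sup>2) n \<partial>lebesgue_on \<Omega>)"
    unfolding frac_diff_def power2_eq_square
    by (rule Bochner_Integration.integral_sum[symmetric]) (auto intro!: int)
  also have "\<dots> \<le> (\<integral>x. 2 * (frac_diff \<alpha> \<theta> t (\<lambda>k. u k x) n * offset \<theta> (\<lambda>k. u k x) n) \<partial>lebesgue_on \<Omega>)"
  proof (rule integral_mono)
    show "integrable (lebesgue_on \<Omega>) (\<lambda>x. frac_diff \<alpha> \<theta> t (\<lambda>k. (u k x)\<^sup>2) n)"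
      unfolding frac_diff_def power2_eq_square
      by (intro Bochner_Integration.integrable_sum integrable_mult_right
          Bochner_Integration.integrable_diff int) auto
    have "(\<lambda>x. 2 * (frac_diff \<alpha> \<theta> t (\<lambda>k. u k x) n * offset \<theta> (\<lambda>k. u k x) n))
        = (\<lambda>x. \<Sum>k=1..n. 2 * A n k * (\<theta> * (u k x * u (n - 1) x) + (1 - \<theta>) * (u k x * u n x)
            - \<theta> * (u (k - 1) x * u (n - 1) x) - (1 - \<theta>) * (u (k - 1) x * u n x)))"
      unfolding frac_diff_def offset_def sum_distrib_left sum_distrib_right
      by (intro ext sum.cong refl) (simp add: algebra_simps)
    then show "integrable (lebesgue_on \<Omega>)
        (\<lambda>x. 2 * (frac_diff \<alpha> \<theta> t (\<lambda>k. u k x) n * offset \<theta> (\<lambda>k. u k x) n))"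
      by (simp only:, intro Bochner_Integration.integrable_sum integrable_mult_right
          Bochner_Integration.integrable_add Bochner_Integration.integrable_diff int) auto
    show "frac_diff \<alpha> \<theta> t (\<lambda>k. (u k x)\<^sup>2) n
        \<le> 2 * (frac_diff \<alpha> \<theta> t (\<lambda>k. u k x) n * offset \<theta> (\<lambda>k. u k x) n)" for x
      using energy_inequality[of n "\<lambda>k. u k x"] assms by (simp add: mult.commute)
  qed
  finally show ?thesis by (simp add: l2_inner_def)
qed


section \<open>Stability of the time-stepping scheme\<close>

theorem theorem2p4:
  fixes \<Omega> :: "'a::euclidean_space set" and \<T> :: "'a set set"
    and f :: "real \<Rightarrow> 'a \<Rightarrow> real" and u :: "nat \<Rightarrow> 'a \<Rightarrow> real" and u0h :: "'a \<Rightarrow> real"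
    and t :: "nat \<Rightarrow> real" and N :: nat and T h \<alpha> \<theta> \<kappa> :: real
  assumes "DIM('a) \<in> {1, 2, 3}"
    and "open \<Omega>" "connected \<Omega>" "bounded \<Omega>" "\<Omega> \<noteq> {}"
    and "simplicial_partition \<Omega> \<T> h"
    and "0 < \<alpha>" "\<alpha> < 1" "\<theta> = \<alpha> / 2"
    and "1 \<le> N" "t 0 = 0" "\<And>k. 1 \<le> k \<Longrightarrow> k \<le> N \<Longrightarrow> t (k - 1) < t k" "t N = T"
    and "\<And>k. 1 \<le> k \<Longrightarrow> k \<le> N - 1 \<Longrightarrow> step_ratio t k \<le> 7 / 4"
    and "\<kappa> > 0 \<Longrightarrow>
           (MAX k\<in>{1..N}. time_step t k) \<le> 1 / (11 * Gamma (2 - \<alpha>) * max \<kappa> 0) powr (1 / \<alpha>)"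
    and "\<And>s. 0 < s \<Longrightarrow> s \<le> T \<Longrightarrow> f s \<in> L2_space \<Omega>"
    and "\<And>n. n \<le> N \<Longrightarrow> u n \<in> fe_space \<Omega> \<T>"
    and "u 0 = u0h"
    and "\<And>n \<phi>. 1 \<le> n \<Longrightarrow> n \<le> N \<Longrightarrow> \<phi> \<in> fe_space \<Omega> \<T> \<Longrightarrow>
           l2_inner \<Omega> (\<lambda>x. frac_diff \<alpha> \<theta> t (\<lambda>k. u k x) n) \<phi>
             + l2_inner \<Omega> (grad (\<lambda>x. offset \<theta> (\<lambda>k. u k x) n)) (grad \<phi>)
           = \<kappa> * l2_inner \<Omega> (\<lambda>x. offset \<theta> (\<lambda>k. u k x) n) \<phi>
             + l2_inner \<Omega> (f (offset \<theta> t n)) \<phi>"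
  shows "\<forall>n\<in>{1..N}.
    l2_norm \<Omega> (u n)
      \<le> 2 * mittag_leffler \<alpha> (20 * max \<kappa> 0 * t n powr \<alpha>) *
          (l2_norm \<Omega> u0h +
           2 * (MAX k\<in>{1..n}. \<Sum>j=1..k. kernel_P \<alpha> \<theta> t k j * l2_norm \<Omega> (f (offset \<theta> t j)))) \<and>
    2 * mittag_leffler \<alpha> (20 * max \<kappa> 0 * t n powr \<alpha>) *
          (l2_norm \<Omega> u0h +
           2 * (MAX k\<in>{1..n}. \<Sum>j=1..k. kernel_P \<alpha> \<theta> t k j * l2_norm \<Omega> (f (offset \<theta> t j))))
      \<le> 2 * mittag_leffler \<alpha> (20 * max \<kappa> 0 * t n powr \<alpha>) *
          (l2_norm \<Omega> u0h +
           6 * Gamma (1 - \<alpha>) *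
             (MAX j\<in>{1..n}. t j powr \<alpha> * l2_norm \<Omega> (f (offset \<theta> t j))))"
proof -
  interpret alikhanov_grid \<alpha> \<theta> t N
    using assms(7-9,11,12,14) by unfold_locales auto
  have u_L2: "u k \<in> L2_space \<Omega>" if "k \<le> N" for k
    using assms(17)[OF that] fe_space_subset_L2_space[OF assms(2,4)] by blast
  have f_L2: "f (\<sigma> n) \<in> L2_space \<Omega>" if "1 \<le> n" "n \<le> N" for n
  proof (rule assms(16))
    show "0 < \<sigma> n" using that by (intro le_less_trans[OF t_nonneg sigma_gt]) auto
    show "\<sigma> n \<le> T" using sigma_lt[OF that] t_mono[of n N] that assms(13) by simp
  qed
  define v where "v k = l2_norm \<Omega> (u k)" for k
  define F where "F j = l2_norm \<Omega> (f (\<sigma> j))" for j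
  have v0: "0 \<le> v k" for k by (simp add: v_def l2_norm_nonneg)
  have F0: "0 \<le> F k" for k by (simp add: F_def l2_norm_nonneg)
  have energy: "frac_diff \<alpha> \<theta> t (\<lambda>k. (v k)\<^sup>2) n
      \<le> 2 * max \<kappa> 0 * (offset \<theta> v n)\<^sup>2 + offset \<theta> v n * (2 * F n)" if n: "1 \<le> n" "n \<le> N" for n
  proof -
    define w where "w x = offset \<theta> (\<lambda>k. u k x) n" for x
    have w_fe: "w \<in> fe_space \<Omega> \<T>"
      unfolding w_def[abs_def] offset_def using n assms(17) by (intro fe_space_lincomb) auto
    have w_L2: "w \<in> L2_space \<Omega>"
      using w_fe fe_space_subset_L2_space[OF assms(2,4)] by blast
    have w_le: "l2_norm \<Omega> w \<le> offset \<theta> v n"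
      unfolding w_def[abs_def] v_def using n u_L2 theta_bounds by (intro l2_norm_offset_le) auto
    have "frac_diff \<alpha> \<theta> t (\<lambda>k. (v k)\<^sup>2) n \<le> 2 * l2_inner \<Omega> (\<lambda>x. frac_diff \<alpha> \<theta> t (\<lambda>k. u k x) n) w"
      unfolding w_def[abs_def] v_def using n u_L2 by (intro l2_energy_inequality) auto
    \<comment> \<open>The scheme is tested with \<open>w\<close>, and the gradient term has a sign.\<close>
    also have "\<dots> \<le> 2 * (\<kappa> * l2_inner \<Omega> w w + l2_inner \<Omega> (f (\<sigma> n)) w)"
    proof -
      have "0 \<le> l2_inner \<Omega> (grad w) (grad w)"
        unfolding l2_inner_def by (rule Bochner_Integration.integral_nonneg) simp
      then show ?thesis
        using assms(19)[OF n w_fe] unfolding w_def[abs_def, symmetric] by simp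
    qed
    also have "\<dots> \<le> 2 * (max \<kappa> 0 * (offset \<theta> v n)\<^sup>2 + F n * offset \<theta> v n)"
    proof (intro mult_left_mono add_mono)
      have "\<kappa> * l2_inner \<Omega> w w \<le> max \<kappa> 0 * (l2_norm \<Omega> w)\<^sup>2"
        unfolding l2_norm_square[symmetric] by (intro mult_right_mono) auto
      also have "\<dots> \<le> max \<kappa> 0 * (offset \<theta> v n)\<^sup>2"
        using w_le by (intro mult_left_mono power_mono l2_norm_nonneg) auto
      finally show "\<kappa> * l2_inner \<Omega> w w \<le> max \<kappa> 0 * (offset \<theta> v n)\<^sup>2" .
      have "l2_inner \<Omega> (f (\<sigma> n)) w \<le> F n * l2_norm \<Omega> w"
        unfolding F_def by (intro l2_Cauchy_Schwarz f_L2 n w_L2)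
      also have "\<dots> \<le> F n * offset \<theta> v n" by (intro mult_left_mono w_le F0)
      finally show "l2_inner \<Omega> (f (\<sigma> n)) w \<le> F n * offset \<theta> v n" .
    qed simp
    finally show ?thesis by (simp add: algebra_simps)
  qed
  have small: "2 * (2 * max \<kappa> 0) * (11 / 4 * Gamma (2 - \<alpha>) * \<tau> n powr \<alpha>) \<le> 1"
    if n: "1 \<le> n" "n \<le> N" for n
  proof (cases "0 < \<kappa>")
    case True
    define c where "c = 11 * Gamma (2 - \<alpha>) * max \<kappa> 0"
    have c: "0 < c" using True alpha by (simp add: c_def)
    have "\<tau> n \<le> (MAX k\<in>{1..N}. \<tau> k)" using n by (intro Max_ge) auto
    also have "\<dots> \<le> 1 / c powr (1 / \<alpha>)" using assms(15)[OF True] by (simp add: c_def)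
    finally have "\<tau> n powr \<alpha> \<le> (1 / c powr (1 / \<alpha>)) powr \<alpha>"
      using tau_pos[OF n] alpha by (intro powr_mono2) auto
    also have "\<dots> = 1 / c" using c alpha by (simp add: powr_divide powr_powr)
    finally have "c * \<tau> n powr \<alpha> \<le> 1" using c by (simp add: pos_le_divide_eq mult.commute)
    then show ?thesis by (simp add: c_def mult_ac)
  qed (simp add: max_def)
  show ?thesis
  proof
    fix n assume n: "n \<in> {1..N}"
    define S where "S k = (\<Sum>j=1..k. P k j * F j)" for k
    define E where "E = mittag_leffler \<alpha> (20 * max \<kappa> 0 * t n powr \<alpha>)"
    define B where "B = (MAX j\<in>{1..n}. t j powr \<alpha> * F j)"
    have S_le: "S k \<le> (MAX k\<in>{1..n}. S k)" if "1 \<le> k" "k \<le> n" for k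
      using that by (intro Max_ge) auto
    have "0 \<le> S 1" unfolding S_def using n F0 by (auto intro!: sum_nonneg mult_nonneg_nonneg kernel_P_nonneg)
    then have S0: "0 \<le> (MAX k\<in>{1..n}. S k)" using n
      by (intro order_trans[OF \<open>0 \<le> S 1\<close> S_le]) auto
    have "v n \<le> 2 * mittag_leffler \<alpha> (10 * (2 * max \<kappa> 0) * t n powr \<alpha>) * (v 0 + 2 * (MAX k\<in>{1..n}. S k))"
    proof (rule discrete_gronwall[where M = n and g = "\<lambda>j. 2 * F j"])
      fix k assume k: "1 \<le> k" "k \<le> n"
      have "(\<Sum>j=1..k. P k j * (2 * F j)) = 2 * S k"
        by (simp add: S_def sum_distrib_left mult_ac)
      then show "(\<Sum>j=1..k. P k j * (2 * F j)) \<le> 2 * (MAX k\<in>{1..n}. S k)"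
        using S_le[OF k] by simp
    qed (use n S0 v0 F0 small energy in auto)
    then have first: "v n \<le> 2 * E * (v 0 + 2 * (MAX k\<in>{1..n}. S k))"
      by (simp add: E_def)
    have B: "t j powr \<alpha> * F j \<le> B" if "1 \<le> j" "j \<le> n" for j
      unfolding B_def using that by (intro Max_ge) auto
    have B0: "0 \<le> B" using B[of 1] F0[of 1] n order_trans[of 0 "t 1 powr \<alpha> * F 1" B] by simp
    have "S k \<le> 11 / 4 * Gamma (1 - \<alpha>) * B" if "k \<in> {1..n}" for k
      unfolding S_def using that n B B0 by (intro kernel_P_sum_le) auto
    then have "(MAX k\<in>{1..n}. S k) \<le> 11 / 4 * Gamma (1 - \<alpha>) * B"
      using n by (intro Max.boundedI) auto
    moreover have "0 \<le> Gamma (1 - \<alpha>) * B" using B0 alpha by simp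
    ultimately have "2 * (MAX k\<in>{1..n}. S k) \<le> 6 * Gamma (1 - \<alpha>) * B" by linarith
    moreover have "0 \<le> 2 * E"
      unfolding E_def using mittag_leffler_ge_1[of \<alpha> "20 * max \<kappa> 0 * t n powr \<alpha>"] alpha by simp
    ultimately have second: "2 * E * (v 0 + 2 * (MAX k\<in>{1..n}. S k))
        \<le> 2 * E * (v 0 + 6 * Gamma (1 - \<alpha>) * B)"
      by (intro mult_left_mono) auto
    show "l2_norm \<Omega> (u n)
        \<le> 2 * mittag_leffler \<alpha> (20 * max \<kappa> 0 * t n powr \<alpha>) *
            (l2_norm \<Omega> u0h +
             2 * (MAX k\<in>{1..n}. \<Sum>j=1..k. kernel_P \<alpha> \<theta> t k j * l2_norm \<Omega> (f (offset \<theta> t j)))) \<and>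
      2 * mittag_leffler \<alpha> (20 * max \<kappa> 0 * t n powr \<alpha>) *
            (l2_norm \<Omega> u0h +
             2 * (MAX k\<in>{1..n}. \<Sum>j=1..k. kernel_P \<alpha> \<theta> t k j * l2_norm \<Omega> (f (offset \<theta> t j))))
        \<le> 2 * mittag_leffler \<alpha> (20 * max \<kappa> 0 * t n powr \<alpha>) *
            (l2_norm \<Omega> u0h +
             6 * Gamma (1 - \<alpha>) *
               (MAX j\<in>{1..n}. t j powr \<alpha> * l2_norm \<Omega> (f (offset \<theta> t j))))"
      using first second assms(18) unfolding E_def S_def B_def F_def v_def by simp
  qed
qed

end
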